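(* There is an absolute constant $K>0$ such that the following holds. For all integers $m\ge n\ge 1$ and all distributions $F_B,F_S$ on $\mathbb{R}$ with $r:=\Pr_{b\sim F_B,s\sim F_S}[b\ge s]\in(0,1)$ (with $b,s$ independent), there exists an integer $c$ with $0\le c\le K\left(1+\frac{\log(m/n)+\log(1/r)}{r}\right)$ such that the expected gains from trade of the Seller Trade Reduction mechanism on $m+c$ buyers with values i.i.d. from $F_B$ and $n+c$ sellers with values i.i.d. from $F_S$ is at least the expected first-best gains from trade with $m$ buyers with values i.i.d. from $F_B$ and $n$ sellers with values i.i.d. from $F_S$, i.e. $\mathrm{STR}(m+c,n+c)\ge\mathrm{OPT}(m,n)$.
   Context: Double auction: unit-demand buyers with values i.i.d. from $F_B$, unit-supply sellers (each holding one identical item) with values i.i.d. from $F_S$, all independent. Given buyer values $b^{(1)}\ge\dots\ge b^{(m)}$ and seller values $s^{(1)}\le\dots\le s^{(n)}$, let $r^*=\max\{i\le\min(m,n): b^{(i)}\ge s^{(i)}\}$ ($r^*=0$ if none). The first-best allocation trades the $r^*$ highest buyers with the $r^*$ lowest sellers, with gains from trade $\sum_{i=1}^{r^*}(b^{(i)}-s^{(i)})$; $\mathrm{OPT}(m,n)$ is its expectation. Seller Trade Reduction: with $s^{(n+1)}=\infty$, if $b^{(r^* )}\ge s^{(r^*+1)}$ the $r^*$ highest buyers trade with the $r^*$ lowest sellers; otherwise only the $r^*-1$ highest buyers trade with the $r^*-1$ lowest sellers. Gains from trade is the sum of traded buyers' values minus traded sellers' values; $\mathrm{STR}(m,n)$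 is its expectation. *)

theory Defs
  imports "HOL-Probability.Probability"
begin

text \<open>Buyer values sorted in decreasing order: entry i-1 is b^(i).\<close>
definition buyer_order :: "nat \<Rightarrow> (nat \<Rightarrow> real) \<Rightarrow> real list" where
  "buyer_order m b = rev (sort (map b [0..<m]))"

text \<open>Seller values sorted in increasing order: entry i-1 is s^(i).\<close>
definition seller_order :: "nat \<Rightarrow> (nat \<Rightarrow> real) \<Rightarrow> real list" where
  "seller_order n s = sort (map s [0..<n])"

definition rstar :: "real list \<Rightarrow> real list \<Rightarrow> nat" where
  "rstar bs ss = Max ({0} \<union> {i. 1 \<le> i \<and> i \<le> min (length bs) (length ss) \<and> ss ! (i - 1) \<le> bs ! (i - 1)})"

definition gft_k :: "real list \<Rightarrow> real list \<Rightarrow> nat \<Rightarrow> real" where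
  "gft_k bs ss k = (\<Sum>i\<in>{1..k}. bs ! (i - 1) - ss ! (i - 1))"

definition gft_opt :: "real list \<Rightarrow> real list \<Rightarrow> real" where
  "gft_opt bs ss = gft_k bs ss (rstar bs ss)"

text \<open>Seller Trade Reduction (s^(n+1) = \<infinity>, so the test fails if r* = n).\<close>
definition gft_str :: "real list \<Rightarrow> real list \<Rightarrow> real" where
  "gft_str bs ss = (let r = rstar bs ss in
     if r < length ss \<and> ss ! r \<le> bs ! (r - 1) then gft_k bs ss r else gft_k bs ss (r - 1))"

definition market :: "nat \<Rightarrow> nat \<Rightarrow> real measure \<Rightarrow> real measure \<Rightarrow> ((nat \<Rightarrow> real) \<times> (nat \<Rightarrow> real)) measure" where
  "market m n FB FS = (PiM {..<m} (\<lambda>_. FB)) \<Otimes>\<^sub>M (PiM {..<n} (\<lambda>_. FS))"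

definition OPT_exp :: "nat \<Rightarrow> nat \<Rightarrow> real measure \<Rightarrow> real measure \<Rightarrow> ennreal" where
  "OPT_exp m n FB FS = (\<integral>\<^sup>+ \<omega>. ennreal (gft_opt (buyer_order m (fst \<omega>)) (seller_order n (snd \<omega>))) \<partial>market m n FB FS)"

definition STR_exp :: "nat \<Rightarrow> nat \<Rightarrow> real measure \<Rightarrow> real measure \<Rightarrow> ennreal" where
  "STR_exp m n FB FS = (\<integral>\<^sup>+ \<omega>. ennreal (gft_str (buyer_order m (fst \<omega>)) (seller_order n (snd \<omega>))) \<partial>market m n FB FS)"

definition trade_prob :: "real measure \<Rightarrow> real measure \<Rightarrow> real" where
  "trade_prob FB FS = measure (FB \<Otimes>\<^sub>M FS) {p. snd p \<le> fst p}"

end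

theory Submission
  imports Defs
begin

text \<open>
  For a price \<open>t\<close> let \<open>B\<^sub>t\<close> be the number of buyers above \<open>t\<close> and \<open>S\<^sub>t\<close> the number of sellers at or
  below \<open>t\<close>. The first-best gains from trade are the integral of \<open>min B\<^sub>t S\<^sub>t\<close> over all prices, and
  Seller Trade Reduction loses at most one unit of this integrand, and only if \<open>1 \<le> S\<^sub>t \<le> B\<^sub>t\<close> and fewer
  than \<open>S\<^sub>t\<close> of the index pairs satisfy \<open>t < s\<^sub>j \<le> b\<^sub>j\<close>. It therefore suffices to compare expected
  integrands price by price.

  Adding \<open>c\<close> agents on each side, of whom \<open>B'\<close> buyers are above and \<open>S'\<close> sellers at or below \<open>t\<close>,
  increases the minimum by \<open>S'\<close> if there are at most as many sellers below as buyers above, and by at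
  least \<open>B'\<close> otherwise. A loss only occurs in the first case and is then paid for by the gain
  unless \<open>S' = 0\<close>. If a seller is below \<open>t\<close> with probability \<open>q \<ge> r / 8\<close>, then \<open>S' = 0\<close> is exponentially
  unlikely. Otherwise a pair satisfies \<open>t < s\<^sub>j \<le> b\<^sub>j\<close> with probability at least \<open>7 r / 8\<close>, so having fewer
  such pairs than sellers below \<open>t\<close> is exponentially unlikely.
\<close>

section \<open>Gains from trade as an integral over prices\<close>

text \<open>In a sorted list the entries at most \<open>t\<close> form an initial segment, so
  position \<open>i\<close> belongs to it iff the segment has more than \<open>i\<close>
  elements.\<close>

lemma sorted_nth_le_iff:
  fixes xs :: "'a::linorder list"
  assumes "sorted xs" and "i < length xs"
  shows "xs ! i \<le> t \<longleftrightarrow> i < length (filter (\<lambda>x. x \<le> t) xs)"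
  using assms
proof (induction xs arbitrary: i)
  case (Cons x xs)
  show ?case
  proof (cases i)
    case 0
    then show ?thesis using Cons.prems
      by (auto simp: filter_empty_conv intro: order_trans)
  next
    case (Suc k)
    moreover have "filter (\<lambda>x. x \<le> t) xs = []" if "\<not> x \<le> t"
      using that Cons.prems(1) by (auto simp: filter_empty_conv)
    ultimately show ?thesis using Cons by auto
  qed
qed simp

lemma length_filter_sort_map:
  "length (filter P (sort (map f [0..<n]))) = card {j \<in> {..<n}. P (f j)}"
proof -
  have "length (filter P (sort (map f [0..<n]))) = length (filter P (map f [0..<n]))"
    by (metis mset_filter mset_sort size_mset)
  also have "\<dots> = length (filter (\<lambda>j. P (f j)) [0..<n])"
    by (simp add: filter_map comp_def)
  also have "\<dots> = card {j \<in> {..<n}. P (f j)}"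
    by (subst distinct_card[symmetric]) (auto intro: arg_cong[where f = card])
  finally show ?thesis .
qed

text \<open>Strict here and weak in \<open>num_below\<close>, matching half-open price intervals:
  \<open>t\<close> separates a pair iff \<open>s \<le> t < b\<close>. The index set \<open>A\<close>
  is general so that original agents and recruits can be counted separately.\<close>

definition num_above :: "nat set \<Rightarrow> real \<Rightarrow> (nat \<Rightarrow> real) \<Rightarrow> nat" where
  "num_above A t b = card {j \<in> A. t < b j}"

definition num_below :: "nat set \<Rightarrow> real \<Rightarrow> (nat \<Rightarrow> real) \<Rightarrow> nat" where
  "num_below A t s = card {j \<in> A. s j \<le> t}"

text \<open>Buyers and sellers are paired by their unsorted indices, which makes the pairs
  independent and identically distributed; these are not the pairs that trade.\<close>

definition num_matched :: "nat set \<Rightarrow> real \<Rightarrow> (nat \<Rightarrow> real) \<Rightarrow> (nat \<Rightarrow> real) \<Rightarrow> nat" where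
  "num_matched A t b s = card {j \<in> A. t < s j \<and> s j \<le> b j}"

lemma length_buyer_order [simp]: "length (buyer_order m b) = m"
  and length_seller_order [simp]: "length (seller_order n s) = n"
  by (simp_all add: buyer_order_def seller_order_def)

lemma seller_order_le_iff:
  assumes "i < n"
  shows "seller_order n s ! i \<le> t \<longleftrightarrow> i < num_below {..<n} t s"
  using sorted_nth_le_iff[of "seller_order n s" i t] assms
  by (simp add: seller_order_def num_below_def length_filter_sort_map)

lemma num_below_compl:
  "num_below {..<m} t b + num_above {..<m} t b = m"
proof -
  have "{..<m} = {j \<in> {..<m}. b j \<le> t} \<union> {j \<in> {..<m}. t < b j}" by auto
  then have "m = card ({j \<in> {..<m}. b j \<le> t} \<union> {j \<in> {..<m}. t < b j})"
    by (metis card_lessThan)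
  also have "\<dots> = num_below {..<m} t b + num_above {..<m} t b"
    unfolding num_below_def num_above_def by (rule card_Un_disjoint) auto
  finally show ?thesis by simp
qed

lemma buyer_order_less_iff:
  assumes "i < m"
  shows "t < buyer_order m b ! i \<longleftrightarrow> i < num_above {..<m} t b"
proof -
  \<comment> \<open>Position \<open>i\<close> from the top is position \<open>m - 1 - i\<close> from
    the bottom, and lying strictly above \<open>t\<close> is the complement of lying at or below
    it.\<close>
  have "buyer_order m b ! i = seller_order m b ! (m - 1 - i)"
    using assms by (simp add: buyer_order_def seller_order_def rev_nth)
  then show ?thesis
    using seller_order_le_iff[of "m - 1 - i" m b t] num_below_compl[of m t b] assms by auto
qed

lemma num_above_le: "num_above {..<m} t b \<le> m"
  and num_below_le: "num_below {..<n} t s \<le> n"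
  using num_below_compl[of m t b] num_below_compl[of n t s] by auto

lemma sorted_seller_order: "sorted (seller_order n s)"
  by (simp add: seller_order_def)

lemma buyer_order_antimono:
  assumes "i \<le> j" "j < m"
  shows "buyer_order m b ! j \<le> buyer_order m b ! i"
  using assms by (auto simp: buyer_order_def rev_nth intro!: sorted_nth_mono)

section \<open>The rank of the last profitable pair\<close>

lemma le_rstar_iff_set:
  assumes "1 \<le> i" "i \<le> length bs" "i \<le> length ss" "ss ! (i - 1) \<le> bs ! (i - 1)"
  shows "i \<le> rstar bs ss"
  unfolding rstar_def using assms by (intro Max_ge) auto

lemma rstar_cases:
  obtains "rstar bs ss = 0"
  | "1 \<le> rstar bs ss" "rstar bs ss \<le> length bs" "rstar bs ss \<le> length ss"
    "ss ! (rstar bs ss - 1) \<le> bs ! (rstar bs ss - 1)"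
proof -
  have "rstar bs ss \<in> {0} \<union> {i. 1 \<le> i \<and> i \<le> min (length bs) (length ss) \<and> ss ! (i - 1) \<le> bs ! (i - 1)}"
    unfolding rstar_def by (rule Max_in) auto
  then show ?thesis using that by auto
qed

context
  fixes m n :: nat and b s :: "nat \<Rightarrow> real"
  and bs ss :: "real list"
  defines "bs \<equiv> buyer_order m b" and "ss \<equiv> seller_order n s"
begin

text \<open>If the minimum is \<open>k > 0\<close>, then the \<open>k\<close>-th highest buyer is
  above \<open>t\<close> and the \<open>k\<close>-th lowest seller at or below it, so the pair of
  rank \<open>k\<close> is profitable.\<close>

lemma trade_count_le_rstar:
  "min (num_above {..<m} t b) (num_below {..<n} t s) \<le> rstar bs ss"
proof (cases "min (num_above {..<m} t b) (num_below {..<n} t s)")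
  case (Suc i)
  then have "t < bs ! i" "ss ! i \<le> t" "i < m" "i < n"
    using buyer_order_less_iff[of i m t b] seller_order_le_iff[of i n s t]
      num_above_le[of m t b] num_below_le[of n t s]
    by (auto simp: bs_def ss_def)
  then show ?thesis
    using Suc le_rstar_iff_set[of "Suc i" bs ss] by (simp add: bs_def ss_def)
qed simp

text \<open>As a maximum, \<open>rstar\<close> only gives information on its own rank; monotonicity
  of both orders passes profitability on to all smaller ranks.\<close>

lemma pair_below_rstar:
  assumes "i < rstar bs ss"
  shows "i < m" "i < n" "ss ! i \<le> bs ! i"
proof -
  consider "1 \<le> rstar bs ss" "rstar bs ss \<le> m" "rstar bs ss \<le> n"
    "ss ! (rstar bs ss - 1) \<le> bs ! (rstar bs ss - 1)"
    using assms by (cases rule: rstar_cases[of bs ss]) (auto simp: bs_def ss_def)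
  then have *: "i < m \<and> i < n \<and> ss ! i \<le> bs ! i"
  proof cases
    case 1
    have "ss ! i \<le> ss ! (rstar bs ss - 1)"
      using assms 1 sorted_nth_mono[OF sorted_seller_order[of n s], of i "rstar bs ss - 1"]
      by (simp add: ss_def)
    moreover have "bs ! (rstar bs ss - 1) \<le> bs ! i"
      using assms 1 unfolding bs_def by (intro buyer_order_antimono) auto
    ultimately show ?thesis using 1 assms by auto
  qed
  show "i < m" "i < n" "ss ! i \<le> bs ! i" using * by auto
qed

text \<open>Layer cake: the pair of rank \<open>i\<close> contributes the length of a price interval, and a price lies
  in it iff at least \<open>i\<close> buyers are above and at least \<open>i\<close> sellers are at or below it.\<close>

lemma gft_k_eq_nn_integral:
  assumes "k \<le> rstar bs ss"
  shows "ennreal (gft_k bs ss k) =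
    (\<integral>\<^sup>+ t. of_nat (min k (min (num_above {..<m} t b) (num_below {..<n} t s))) \<partial>lborel)"
proof -
  have le: "i < m" "i < n" "ss ! i \<le> bs ! i" if "i < k" for i
    using pair_below_rstar[of i] that assms by auto
  have "gft_k bs ss k = (\<Sum>i<k. bs ! i - ss ! i)"
    unfolding gft_k_def
    by (rule sum.reindex_bij_witness[where i = Suc and j = "\<lambda>i. i - 1"]) auto
  then have "ennreal (gft_k bs ss k) = (\<Sum>i<k. ennreal (bs ! i - ss ! i))"
    using le by (subst sum_ennreal) auto
  also have "\<dots> = (\<Sum>i<k. \<integral>\<^sup>+ t. indicator {ss ! i..<bs ! i} t \<partial>lborel)"
    using le by (intro sum.cong) auto
  also have "\<dots> = (\<integral>\<^sup>+ t. (\<Sum>i<k. indicator {ss ! i..<bs ! i} t) \<partial>lborel)"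
    by (rule nn_integral_sum[symmetric]) auto
  also have "\<dots> = (\<integral>\<^sup>+ t. of_nat (min k (min (num_above {..<m} t b) (num_below {..<n} t s))) \<partial>lborel)"
  proof (rule nn_integral_cong)
    fix t
    have "(\<Sum>i<k. indicator {ss ! i..<bs ! i} t :: ennreal) =
        (\<Sum>i<k. indicator {..<min (num_above {..<m} t b) (num_below {..<n} t s)} i)"
      using le buyer_order_less_iff[of _ m t b] seller_order_le_iff[of _ n s t]
      by (intro sum.cong) (auto simp: indicator_def bs_def ss_def)
    also have "\<dots> = of_nat (card ({..<k} \<inter> {..<min (num_above {..<m} t b) (num_below {..<n} t s)}))"
      by (simp add: indicator_def sum.If_cases Int_def lessThan_def)
    also have "{..<k} \<inter> {..<min (num_above {..<m} t b) (num_below {..<n} t s)} =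
        {..<min k (min (num_above {..<m} t b) (num_below {..<n} t s))}"
      by auto
    also have "of_nat (card \<dots>) = of_nat (min k (min (num_above {..<m} t b) (num_below {..<n} t s)))"
      by (simp only: card_lessThan)
    finally show "(\<Sum>i<k. indicator {ss ! i..<bs ! i} t :: ennreal) = \<dots>" .
  qed
  finally show ?thesis .
qed

lemma gft_opt_eq_nn_integral:
  "ennreal (gft_opt bs ss) =
    (\<integral>\<^sup>+ t. of_nat (min (num_above {..<m} t b) (num_below {..<n} t s)) \<partial>lborel)"
  unfolding gft_opt_def
  by (subst gft_k_eq_nn_integral) (auto intro!: nn_integral_cong simp: min_absorb2 trade_count_le_rstar)

text \<open>Let \<open>x\<close> be the value of the buyer of rank \<open>Suc k\<close>. The
  reduction means that at most \<open>Suc k\<close> sellers are at or below \<open>x\<close>, and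
  \<open>Suc k\<close> of them are already at or below \<open>t\<close>, so no seller lies in
  \<open>(t, x]\<close>. A matched pair above \<open>t\<close> thus has its buyer above
  \<open>x\<close>, and there are at most \<open>k\<close> such buyers.\<close>

lemma reduced_trade_bound:
  assumes "n \<le> m" and r: "rstar bs ss = Suc k"
    and red: "\<not> (rstar bs ss < length ss \<and> ss ! rstar bs ss \<le> bs ! (rstar bs ss - 1))"
    and full: "min (num_above {..<m} t b) (num_below {..<n} t s) = Suc k"
  shows "num_below {..<n} t s \<le> num_above {..<m} t b"
    and "num_matched {..<n} t b s < num_below {..<n} t s"
proof -
  define x where "x = bs ! k"
  have km: "k < m" "k < n" using pair_below_rstar[of k] r by auto
  have tx: "t < x"
    using full buyer_order_less_iff[OF km(1), of t b] by (simp add: x_def bs_def)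
  have Sx: "num_below {..<n} x s \<le> Suc k"
  proof (cases "Suc k < n")
    case True
    then show ?thesis
      using red r seller_order_le_iff[OF True, of s x] by (simp add: x_def ss_def)
  next
    \<comment> \<open>Here every seller trades in the first-best allocation; this is the convention
      that the seller of rank \<open>n + 1\<close> has value infinity.\<close>
    case False
    then show ?thesis using num_below_le[of n x s] by simp
  qed
  have sub: "{j \<in> {..<n}. s j \<le> t} \<subseteq> {j \<in> {..<n}. s j \<le> x}" using tx by auto
  have "num_below {..<n} t s \<le> num_below {..<n} x s"
    unfolding num_below_def using sub by (intro card_mono) auto
  then have St: "num_below {..<n} t s = Suc k" "num_below {..<n} x s = Suc k"
    using Sx full by auto
  show "num_below {..<n} t s \<le> num_above {..<m} t b" using St full by linarith
  have eq: "{j \<in> {..<n}. s j \<le> t} = {j \<in> {..<n}. s j \<le> x}"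
    using sub St unfolding num_below_def by (intro card_subset_eq) auto
  have "{j \<in> {..<n}. t < s j \<and> s j \<le> b j} \<subseteq> {j \<in> {..<m}. x < b j}"
  proof
    fix j assume j: "j \<in> {j \<in> {..<n}. t < s j \<and> s j \<le> b j}"
    then have "j \<notin> {j \<in> {..<n}. s j \<le> x}" unfolding eq[symmetric] by auto
    then show "j \<in> {j \<in> {..<m}. x < b j}" using j \<open>n \<le> m\<close> by auto
  qed
  then have "num_matched {..<n} t b s \<le> num_above {..<m} x b"
    unfolding num_matched_def num_above_def by (intro card_mono) auto
  also have "\<dots> \<le> k"
    using buyer_order_less_iff[OF km(1), of x b] by (simp add: x_def bs_def)
  finally show "num_matched {..<n} t b s < num_below {..<n} t s" using St by simp
qed

end

text \<open>A superset, phrased through counts at price \<open>t\<close> only, of the event that Seller Trade Reduction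
  sacrifices a pair straddling \<open>t\<close>. The last condition follows because a sacrificed last pair leaves
  no seller between \<open>t\<close> and the \<open>r\<^sup>*\<close>-th buyer, so a matched pair above \<open>t\<close> would put its buyer
  strictly above that buyer.\<close>

definition lossy :: "nat \<Rightarrow> nat \<Rightarrow> real \<Rightarrow> (nat \<Rightarrow> real) \<Rightarrow> (nat \<Rightarrow> real) \<Rightarrow> bool" where
  "lossy m n t b s \<longleftrightarrow> 1 \<le> num_below {..<n} t s \<and> num_below {..<n} t s \<le> num_above {..<m} t b
     \<and> num_matched {..<n} t b s < num_below {..<n} t s"

text \<open>The mechanism trades the first \<open>k\<close> ranks, with \<open>k\<close> either
  \<open>rstar\<close> or one less, so its integrand at \<open>t\<close> is the trade count capped
  at \<open>k\<close>. The cap binds only if a pair was sacrificed and the count equals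
  \<open>rstar\<close>, and then \<open>lossy\<close> holds at \<open>t\<close>.\<close>

lemma gft_str_ge_nn_integral:
  assumes "n \<le> m"
  shows "(\<integral>\<^sup>+ t. of_nat (min (num_above {..<m} t b) (num_below {..<n} t s) - of_bool (lossy m n t b s)) \<partial>lborel)
    \<le> ennreal (gft_str (buyer_order m b) (seller_order n s))"
proof -
  define bs ss where "bs = buyer_order m b" and "ss = seller_order n s"
  note defs = bs_def ss_def
  let ?c = "\<lambda>t. min (num_above {..<m} t b) (num_below {..<n} t s)"
  define red where "red \<longleftrightarrow> \<not> (rstar bs ss < length ss \<and> ss ! rstar bs ss \<le> bs ! (rstar bs ss - 1))"
  define k where "k = (if red then rstar bs ss - 1 else rstar bs ss)"
  have "?c t - of_bool (lossy m n t b s) \<le> min k (?c t)" for t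
  proof (cases "?c t \<le> k")
    case False
    have c: "?c t \<le> rstar bs ss"
      unfolding defs by (rule trade_count_le_rstar)
    with False have k: "red" "rstar bs ss = Suc k" "?c t = Suc k"
      by (auto simp: k_def split: if_splits)
    have "lossy m n t b s"
      using reduced_trade_bound[OF assms, of b s k t] k
      unfolding red_def defs lossy_def by auto
    then show ?thesis using k(3) by simp
  qed auto
  then have "(\<integral>\<^sup>+ t. of_nat (?c t - of_bool (lossy m n t b s)) \<partial>lborel) \<le>
      (\<integral>\<^sup>+ t. of_nat (min k (?c t)) \<partial>lborel)"
    by (intro nn_integral_mono of_nat_mono)
  also have "\<dots> = ennreal (gft_k bs ss k)"
    unfolding defs by (rule gft_k_eq_nn_integral[symmetric]) (auto simp: k_def red_def defs)
  also have "gft_k bs ss k = gft_str bs ss"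
    by (simp add: gft_str_def k_def red_def Let_def)
  finally show ?thesis unfolding defs .
qed

section \<open>Reduction to a fixed price\<close>

lemma measurable_num_above [measurable (raw)]:
  assumes "finite A" "\<And>j. j \<in> A \<Longrightarrow> (\<lambda>x. f x j) \<in> borel_measurable M"
    and [measurable]: "g \<in> borel_measurable M"
  shows "(\<lambda>x. num_above A (g x) (f x)) \<in> measurable M (count_space UNIV)"
  unfolding num_above_def
proof (rule measurable_card)
  fix j
  show "{x \<in> space M. j \<in> {j \<in> A. g x < f x j}} \<in> sets M"
    using assms(2)[of j, measurable] by (cases "j \<in> A") simp_all
qed

lemma measurable_num_below [measurable (raw)]:
  assumes "finite A" "\<And>j. j \<in> A \<Longrightarrow> (\<lambda>x. f x j) \<in> borel_measurable M"
    and [measurable]: "g \<in> borel_measurable M"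
  shows "(\<lambda>x. num_below A (g x) (f x)) \<in> measurable M (count_space UNIV)"
  unfolding num_below_def
proof (rule measurable_card)
  fix j
  show "{x \<in> space M. j \<in> {j \<in> A. f x j \<le> g x}} \<in> sets M"
    using assms(2)[of j, measurable] by (cases "j \<in> A") simp_all
qed

lemma measurable_num_matched [measurable (raw)]:
  assumes "finite A" "\<And>j. j \<in> A \<Longrightarrow> (\<lambda>x. f x j) \<in> borel_measurable M"
    "\<And>j. j \<in> A \<Longrightarrow> (\<lambda>x. h x j) \<in> borel_measurable M"
    and [measurable]: "g \<in> borel_measurable M"
  shows "(\<lambda>x. num_matched A (g x) (f x) (h x)) \<in> measurable M (count_space UNIV)"
  unfolding num_matched_def
proof (rule measurable_card)
  fix j
  show "{x \<in> space M. j \<in> {j \<in> A. g x < h x j \<and> h x j \<le> f x j}} \<in> sets M"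
    using assms(2,3)[of j, measurable] by (cases "j \<in> A") simp_all
qed

locale double_auction =
  B: prob_space FB + S: prob_space FS
  for FB FS :: "real measure" +
  assumes sets_FB [measurable_cong]: "sets FB = sets borel"
    and sets_FS [measurable_cong]: "sets FS = sets borel"
begin

abbreviation PB where "PB m \<equiv> PiM {..<m::nat} (\<lambda>_. FB)"
abbreviation PS where "PS n \<equiv> PiM {..<n::nat} (\<lambda>_. FS)"

sublocale PB: product_prob_space "\<lambda>_::nat. FB" ..
sublocale PS: product_prob_space "\<lambda>_::nat. FS" ..

sublocale BS: pair_prob_space FB FS ..

lemma prob_space_PB: "prob_space (PB m)" by (intro prob_space_PiM B.prob_space_axioms)
lemma prob_space_PS: "prob_space (PS n)" by (intro prob_space_PiM S.prob_space_axioms)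

lemma pair_prob_space_market: "pair_prob_space (PB m) (PS n)"
  by (simp add: pair_prob_space_def pair_sigma_finite_def prob_space_PB prob_space_PS prob_space_imp_sigma_finite)

lemma prob_space_market: "prob_space (market m n FB FS)"
  unfolding market_def by (intro prob_space_pair prob_space_PB prob_space_PS)

lemma measurable_PB_component: "j < m \<Longrightarrow> (\<lambda>b. b j) \<in> borel_measurable (PB m)"
  using measurable_component_singleton[of j "{..<m}" "\<lambda>_. FB"]
  by (simp add: measurable_cong_sets[OF refl sets_FB])

lemma measurable_PS_component: "j < n \<Longrightarrow> (\<lambda>s. s j) \<in> borel_measurable (PS n)"
  using measurable_component_singleton[of j "{..<n}" "\<lambda>_. FS"]
  by (simp add: measurable_cong_sets[OF refl sets_FS])

lemma measurable_market_component:
  "j < m \<Longrightarrow> (\<lambda>\<omega>. fst \<omega> j) \<in> borel_measurable (market m n FB FS)"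
  "j < n \<Longrightarrow> (\<lambda>\<omega>. snd \<omega> j) \<in> borel_measurable (market m n FB FS)"
  unfolding market_def
  using measurable_compose[OF measurable_fst measurable_PB_component]
    measurable_compose[OF measurable_snd measurable_PS_component] by blast+

lemma measurable_market_lborel_component:
  "j < m \<Longrightarrow> (\<lambda>x. fst (fst x) j) \<in> borel_measurable (market m n FB FS \<Otimes>\<^sub>M lborel)"
  "j < n \<Longrightarrow> (\<lambda>x. snd (fst x) j) \<in> borel_measurable (market m n FB FS \<Otimes>\<^sub>M lborel)"
  using measurable_compose[OF measurable_fst measurable_market_component(1)]
    measurable_compose[OF measurable_fst measurable_market_component(2)] by blast+

lemma market_lborel_swap:
  assumes "(\<lambda>x. f (fst x) (snd x)) \<in> borel_measurable (market m n FB FS \<Otimes>\<^sub>M lborel)"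
  shows "(\<integral>\<^sup>+ \<omega>. (\<integral>\<^sup>+ t. f \<omega> t \<partial>lborel) \<partial>market m n FB FS) =
    (\<integral>\<^sup>+ t. (\<integral>\<^sup>+ \<omega>. f \<omega> t \<partial>market m n FB FS) \<partial>lborel)"
proof -
  interpret pair_sigma_finite "market m n FB FS" lborel
    by (simp add: pair_sigma_finite_def prob_space_imp_sigma_finite prob_space_market lborel.sigma_finite_measure_axioms)
  show ?thesis using Fubini'[of f] assms by (simp add: case_prod_unfold)
qed

lemma OPT_exp_eq:
  "OPT_exp m n FB FS = (\<integral>\<^sup>+ t. (\<integral>\<^sup>+ \<omega>. of_nat (min (num_above {..<m} t (fst \<omega>)) (num_below {..<n} t (snd \<omega>)))
     \<partial>market m n FB FS) \<partial>lborel)"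
proof -
  note [measurable] = measurable_market_lborel_component
  show ?thesis
    unfolding OPT_exp_def gft_opt_eq_nn_integral
    by (rule market_lborel_swap) measurable
qed

lemma STR_exp_ge:
  assumes "n \<le> m"
  shows "(\<integral>\<^sup>+ t. (\<integral>\<^sup>+ \<omega>. of_nat (min (num_above {..<m} t (fst \<omega>)) (num_below {..<n} t (snd \<omega>))
       - of_bool (lossy m n t (fst \<omega>) (snd \<omega>))) \<partial>market m n FB FS) \<partial>lborel)
    \<le> STR_exp m n FB FS"
proof -
  note [measurable] = measurable_market_lborel_component
  \<comment> \<open>\<open>num_matched\<close> reads the buyers with index below \<open>n\<close>,
    which exist because \<open>n \<le> m\<close>.\<close>
  have [measurable]: "j < n \<Longrightarrow> (\<lambda>x. fst (fst x) j) \<in> borel_measurable (market m n FB FS \<Otimes>\<^sub>M lborel)" for j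
    using assms measurable_market_lborel_component(1)[of j m n] by simp
  show ?thesis
    unfolding STR_exp_def
    apply (subst market_lborel_swap[symmetric])
    subgoal unfolding lossy_def of_bool_def by measurable
    by (intro nn_integral_mono gft_str_ge_nn_integral assms)
qed

text \<open>The smaller market is a coordinate projection of the larger one. This couples both on
  one probability space, with the recruits as the additional coordinates.\<close>

lemma nn_integral_market_restrict:
  assumes "m \<le> M" "n \<le> N"
    and meas: "f \<in> borel_measurable (market m n FB FS)"
    and restr: "\<And>b s. f (restrict b {..<m}, restrict s {..<n}) = f (b, s)"
  shows "(\<integral>\<^sup>+ \<omega>. f \<omega> \<partial>market m n FB FS) = (\<integral>\<^sup>+ \<omega>. f \<omega> \<partial>market M N FB FS)"
proof -
  have PB: "PB m = distr (PB M) (PB m) (\<lambda>b. restrict b {..<m})"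
    using assms by (intro PB.distr_restrict) auto
  have PS: "PS n = distr (PS N) (PS n) (\<lambda>s. restrict s {..<n})"
    using assms by (intro PS.distr_restrict) auto
  have [measurable]: "(\<lambda>b. restrict b {..<m}) \<in> measurable (PB M) (PB m)"
    "(\<lambda>s. restrict s {..<n}) \<in> measurable (PS N) (PS n)"
    using assms by (auto intro!: measurable_restrict_subset simp: subset_eq)
  have "sigma_finite_measure (distr (PS N) (PS n) (\<lambda>s. restrict s {..<n}))"
    using PS prob_space_PS by (metis prob_space_imp_sigma_finite)
  then have "market m n FB FS = distr (market M N FB FS) (market m n FB FS)
      (\<lambda>(b, s). (restrict b {..<m}, restrict s {..<n}))"
    unfolding market_def by (subst PB, subst PS, subst pair_measure_distr) simp_all
  then have "(\<integral>\<^sup>+ \<omega>. f \<omega> \<partial>market m n FB FS) =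
     (\<integral>\<^sup>+ \<omega>. f \<omega> \<partial>distr (market M N FB FS) (market m n FB FS) (\<lambda>(b, s). (restrict b {..<m}, restrict s {..<n})))"
    by simp
  also have "\<dots> = (\<integral>\<^sup>+ \<omega>. f ((\<lambda>(b, s). (restrict b {..<m}, restrict s {..<n})) \<omega>) \<partial>market M N FB FS)"
    by (intro nn_integral_distr) (use meas in \<open>simp_all add: market_def\<close>)
  also have "\<dots> = (\<integral>\<^sup>+ \<omega>. f \<omega> \<partial>market M N FB FS)"
    by (simp add: case_prod_unfold restr)
  finally show ?thesis .
qed

end

section \<open>Moments of counts in product spaces\<close>

lemma (in prob_space) nn_integral_two_valued:
  assumes [measurable]: "E \<in> sets M" and "0 \<le> u"
  shows "(\<integral>\<^sup>+ x. ennreal (if x \<in> E then u else 1) \<partial>M) = ennreal (1 - (1 - u) * prob E)"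
proof -
  have "(\<integral>\<^sup>+ x. ennreal (if x \<in> E then u else 1) \<partial>M) =
      (\<integral>\<^sup>+ x. ennreal u * indicator E x + indicator (space M - E) x \<partial>M)"
    by (intro nn_integral_cong) (auto simp: indicator_def)
  also have "\<dots> = ennreal u * emeasure M E + emeasure M (space M - E)"
    by (simp add: nn_integral_add nn_integral_cmult)
  also have "\<dots> = ennreal (u * prob E + prob (space M - E))"
    using \<open>0 \<le> u\<close> by (simp add: emeasure_eq_measure ennreal_mult'' ennreal_plus)
  also have "u * prob E + prob (space M - E) = 1 - (1 - u) * prob E"
    by (simp add: prob_compl algebra_simps)
  finally show ?thesis .
qed

text \<open>Counts over disjoint index sets are independent binomials, and this is their joint
  probability generating function. At \<open>u = 0\<close> the power is the indicator of a zero
  count, by \<open>0 ^ 0 = 1\<close>.\<close>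

lemma (in prob_space) nn_integral_PiM_generating:
  assumes "finite I" "A \<subseteq> I" "A' \<subseteq> I" "A \<inter> A' = {}"
    and [measurable]: "E \<in> sets M" and "0 \<le> u" "0 \<le> v"
  shows "(\<integral>\<^sup>+ x. ennreal (u ^ card {i \<in> A. x i \<in> E} * v ^ card {i \<in> A'. x i \<in> E}) \<partial>PiM I (\<lambda>_. M)) =
    ennreal ((1 - (1 - u) * prob E) ^ card A * (1 - (1 - v) * prob E) ^ card A')"
proof -
  interpret P: product_prob_space "\<lambda>_. M" ..
  have fin: "finite A" "finite A'" using assms finite_subset by auto
  define h where "h i y = (if i \<in> A then if y \<in> E then u else 1 else if i \<in> A' then if y \<in> E then v else 1 else 1)"
    for i y
  define z where "z i = (if i \<in> A then 1 - (1 - u) * prob E else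
      if i \<in> A' then 1 - (1 - v) * prob E else 1)" for i
  have split: "prod f I = prod f A * prod f A'" if "\<And>i. i \<in> I - (A \<union> A') \<Longrightarrow> f i = 1" for f :: "_ \<Rightarrow> real"
    using prod.mono_neutral_right[of I "A \<union> A'" f] prod.union_disjoint[of A A' f] that assms fin by auto
  have pr: "0 \<le> 1 - (1 - w) * prob E" if "0 \<le> w" for w
  proof -
    have "(1 - w) * prob E \<le> 1 * prob E"
      using that by (intro mult_right_mono) auto
    then show ?thesis using prob_le_1[of E] by linarith
  qed
  have "u ^ card {i \<in> A. x i \<in> E} * v ^ card {i \<in> A'. x i \<in> E} = (\<Prod>i\<in>I. h i (x i))" for x
  proof -
    have "u ^ card {i \<in> A. x i \<in> E} = (\<Prod>i\<in>A. h i (x i))"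
      unfolding prod_constant[symmetric] prod.inter_filter[OF fin(1)]
      by (intro prod.cong) (auto simp: h_def)
    moreover have "v ^ card {i \<in> A'. x i \<in> E} = (\<Prod>i\<in>A'. h i (x i))"
      unfolding prod_constant[symmetric] prod.inter_filter[OF fin(2)]
      using assms(4) by (intro prod.cong) (auto simp: h_def)
    ultimately show ?thesis by (subst split) (auto simp: h_def)
  qed
  then have "(\<integral>\<^sup>+ x. ennreal (u ^ card {i \<in> A. x i \<in> E} * v ^ card {i \<in> A'. x i \<in> E}) \<partial>PiM I (\<lambda>_. M)) =
      (\<integral>\<^sup>+ x. (\<Prod>i\<in>I. ennreal (h i (x i))) \<partial>PiM I (\<lambda>_. M))"
    using assms by (simp add: prod_ennreal h_def)
  also have "\<dots> = (\<Prod>i\<in>I. \<integral>\<^sup>+ y. ennreal (h i y) \<partial>M)"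
    using assms(1) by (intro P.product_nn_integral_prod) (simp_all add: h_def)
  also have "\<dots> = (\<Prod>i\<in>I. ennreal (z i))"
    using assms nn_integral_two_valued[of E u] nn_integral_two_valued[of E v]
    by (intro prod.cong) (simp_all add: h_def z_def emeasure_space_1)
  also have "\<dots> = ennreal (prod z I)"
    using pr assms by (intro prod_ennreal) (auto simp: z_def)
  also have "prod z I = prod z A * prod z A'"
    by (rule split) (simp add: z_def)
  also have "prod z A = (\<Prod>i\<in>A. 1 - (1 - u) * prob E)"
    by (rule prod.cong) (simp_all add: z_def)
  also have "prod z A' = (\<Prod>i\<in>A'. 1 - (1 - v) * prob E)"
    using assms(4) by (intro prod.cong) (auto simp: z_def)
  finally show ?thesis by simp
qed

text \<open>Meant for \<open>f\<close> the indicator of an event and \<open>h\<close> a quantity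
  that is at least 1 off this event and whose expectation is known from a generating
  function.\<close>

lemma (in prob_space) nn_integral_ge_compl:
  assumes [measurable]: "f \<in> borel_measurable M" "h \<in> borel_measurable M"
    and "\<And>x. 1 \<le> f x + h x" and "(\<integral>\<^sup>+ x. h x \<partial>M) \<le> ennreal y" "0 \<le> y"
  shows "ennreal (1 - y) \<le> (\<integral>\<^sup>+ x. f x \<partial>M)"
proof -
  have "1 = (\<integral>\<^sup>+ x. 1 \<partial>M)" by (simp add: emeasure_space_1)
  also have "\<dots> \<le> (\<integral>\<^sup>+ x. f x + h x \<partial>M)"
    by (intro nn_integral_mono assms)
  also have "\<dots> = (\<integral>\<^sup>+ x. f x \<partial>M) + (\<integral>\<^sup>+ x. h x \<partial>M)"
    by (rule nn_integral_add) measurable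
  also have "\<dots> \<le> (\<integral>\<^sup>+ x. f x \<partial>M) + ennreal y"
    by (intro add_left_mono assms)
  finally have "ennreal 1 - ennreal y \<le> (\<integral>\<^sup>+ x. f x \<partial>M)"
    by (simp add: ennreal_minus_le_iff add.commute)
  then show ?thesis using \<open>0 \<le> y\<close> by (simp add: ennreal_minus flip: ennreal_1)
qed

context double_auction
begin

lemma nn_integral_num_above:
  "(\<integral>\<^sup>+ b. of_nat (num_above {..<m} t b) \<partial>PB m) = ennreal (real m * B.prob {t<..})"
proof -
  have [simp]: "(\<integral>\<^sup>+ b. indicator {t<..} (b i) \<partial>PB m) = ennreal (B.prob {t<..})" if "i < m" for i
  proof -
    have "(\<integral>\<^sup>+ b. indicator {t<..} (b i) \<partial>PB m) = (\<integral>\<^sup>+ y. indicator {t<..} y \<partial>distr (PB m) FB (\<lambda>b. b i))"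
      using that by (subst nn_integral_distr) (simp_all)
    also have "distr (PB m) FB (\<lambda>b. b i) = FB"
      using that by (intro distr_PiM_component) (auto intro: B.prob_space_axioms)
    finally show ?thesis by (simp add: B.emeasure_eq_measure sets_FB)
  qed
  have "of_nat (num_above {..<m} t b) = (\<Sum>i<m. indicator {t<..} (b i) :: ennreal)" for b
    by (simp add: num_above_def indicator_def sum.If_cases Int_def)
  then have "(\<integral>\<^sup>+ b. of_nat (num_above {..<m} t b) \<partial>PB m) = (\<Sum>i<m. \<integral>\<^sup>+ b. indicator {t<..} (b i) \<partial>PB m)"
    using measurable_PB_component[of _ m] by (subst nn_integral_sum[symmetric]) (simp_all)
  also have "\<dots> = ennreal (real m * B.prob {t<..})"
    by (simp add: ennreal_mult ennreal_of_nat_eq_real_of_nat)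
  finally show ?thesis .
qed

lemma nn_integral_market_mult:
  assumes [measurable]: "f \<in> borel_measurable (PB m)" "g \<in> borel_measurable (PS n)"
  shows "(\<integral>\<^sup>+ \<omega>. f (fst \<omega>) * g (snd \<omega>) \<partial>market m n FB FS) = (\<integral>\<^sup>+ b. f b \<partial>PB m) * (\<integral>\<^sup>+ s. g s \<partial>PS n)"
proof -
  interpret pair_prob_space "PB m" "PS n" by (rule pair_prob_space_market)
  have "(\<integral>\<^sup>+ \<omega>. f (fst \<omega>) * g (snd \<omega>) \<partial>market m n FB FS) = (\<integral>\<^sup>+ b. (\<integral>\<^sup>+ s. f b * g s \<partial>PS n) \<partial>PB m)"
    unfolding market_def by (subst M2.nn_integral_fst[symmetric]) simp_all
  then show ?thesis by (simp add: nn_integral_cmult nn_integral_multc)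
qed

text \<open>The first \<open>N\<close> buyers and sellers form independent pairs with law
  \<open>FB \<Otimes>\<^sub>M FS\<close>. Integrating over the buyers for fixed sellers, and then
  over the sellers, makes the expectation factor.\<close>

lemma nn_integral_market_prod:
  assumes "N \<le> M" and [measurable]: "\<And>i. i < N \<Longrightarrow> (\<lambda>(x, y). h i x y) \<in> borel_measurable (FB \<Otimes>\<^sub>M FS)"
  shows "(\<integral>\<^sup>+ \<omega>. (\<Prod>i<N. h i (fst \<omega> i) (snd \<omega> i)) \<partial>market M N FB FS) =
    (\<Prod>i<N. (\<integral>\<^sup>+ x. h i (fst x) (snd x) \<partial>(FB \<Otimes>\<^sub>M FS)))"
proof -
  interpret PP: pair_prob_space "PB M" "PS N" by (rule pair_prob_space_market)
  \<comment> \<open>Padding by the factor 1 extends the product to all \<open>M\<close> buyers, as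
    the product integral over \<open>PB M\<close> requires; the surplus buyers integrate to
    1.\<close>
  define k where "k i x y = (if i < N then h i x y else 1)" for i x y
  have k [measurable]: "(\<lambda>x. k i (fst x) (snd x)) \<in> borel_measurable (FB \<Otimes>\<^sub>M FS)" for i
    using assms(2)[of i] by (cases "i < N") (simp_all add: k_def case_prod_unfold)
  have kx: "(\<lambda>x. k i x y) \<in> borel_measurable FB" for i y
  proof -
    have "y \<in> space FS" using sets_eq_imp_space_eq[OF sets_FS] by simp
    then have "(\<lambda>x. (x, y)) \<in> measurable FB (FB \<Otimes>\<^sub>M FS)" by measurable
    from measurable_compose[OF this k] show ?thesis by simp
  qed
  have trunc: "(\<Prod>i<N. f i) = (\<Prod>i<M. if i < N then f i else 1)" for f :: "nat \<Rightarrow> ennreal"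
    using assms(1) by (intro prod.mono_neutral_cong_left) auto
  have comp: "(\<lambda>x. k i (fst x i) (snd x i)) \<in> borel_measurable (PB M \<Otimes>\<^sub>M PS N)" if "i < N" for i
  proof -
    have "(\<lambda>x. (fst x i, snd x i)) \<in> measurable (PB M \<Otimes>\<^sub>M PS N) (FB \<Otimes>\<^sub>M FS)"
      using that assms(1) by (intro measurable_Pair)
        (auto intro!: measurable_compose[OF measurable_fst] measurable_compose[OF measurable_snd] measurable_component_singleton)
    from measurable_compose[OF this k[of i]] show ?thesis by simp
  qed
  have "(\<integral>\<^sup>+ \<omega>. (\<Prod>i<N. h i (fst \<omega> i) (snd \<omega> i)) \<partial>market M N FB FS) =
      (\<integral>\<^sup>+ \<omega>. (\<Prod>i<N. k i (fst \<omega> i) (snd \<omega> i)) \<partial>(PB M \<Otimes>\<^sub>M PS N))"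
    by (simp add: market_def k_def)
  also have "\<dots> = (\<integral>\<^sup>+ s. (\<integral>\<^sup>+ b. (\<Prod>i<N. k i (b i) (s i)) \<partial>PB M) \<partial>PS N)"
    using comp by (subst PP.nn_integral_snd[symmetric]) (auto simp: case_prod_unfold intro!: borel_measurable_prod)
  also have "\<dots> = (\<integral>\<^sup>+ s. (\<Prod>i<N. \<integral>\<^sup>+ x. k i x (s i) \<partial>FB) \<partial>PS N)"
  proof (rule nn_integral_cong)
    fix s
    have "(\<integral>\<^sup>+ b. (\<Prod>i<N. k i (b i) (s i)) \<partial>PB M) = (\<integral>\<^sup>+ b. (\<Prod>i<M. k i (b i) (s i)) \<partial>PB M)"
      by (subst trunc) (auto intro!: nn_integral_cong prod.cong simp: k_def)
    also have "\<dots> = (\<Prod>i<M. \<integral>\<^sup>+ x. k i x (s i) \<partial>FB)"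
      by (intro PB.product_nn_integral_prod kx) auto
    also have "\<dots> = (\<Prod>i<N. \<integral>\<^sup>+ x. k i x (s i) \<partial>FB)"
      by (subst trunc) (auto intro!: prod.cong simp: k_def B.emeasure_space_1)
    finally show "(\<integral>\<^sup>+ b. (\<Prod>i<N. k i (b i) (s i)) \<partial>PB M) = \<dots>" .
  qed
  also have "\<dots> = (\<Prod>i<N. \<integral>\<^sup>+ y. (\<integral>\<^sup>+ x. k i x y \<partial>FB) \<partial>FS)"
    using measurable_pair_swap[OF k]
    by (intro PS.product_nn_integral_prod B.borel_measurable_nn_integral) (auto simp: case_prod_unfold)
  also have "\<dots> = (\<Prod>i<N. (\<integral>\<^sup>+ x. k i (fst x) (snd x) \<partial>(FB \<Otimes>\<^sub>M FS)))"
    using BS.nn_integral_snd[of "\<lambda>x. k _ (fst x) (snd x)"] k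
    by (intro prod.cong refl) (simp add: case_prod_unfold)
  finally show ?thesis by (simp add: k_def)
qed

end

section \<open>Balancing gain and loss numerically\<close>

lemma one_minus_power_le_exp:
  fixes x :: real
  assumes "0 \<le> x" "x \<le> 1"
  shows "(1 - x) ^ k \<le> exp (- (real k * x))"
proof -
  have "(1 - x) ^ k \<le> exp (- x) ^ k"
    using assms exp_ge_add_one_self[of "- x"] by (intro power_mono) auto
  then show ?thesis by (simp flip: exp_of_nat_mult)
qed

text \<open>The chance of a success in \<open>k\<close> trials is at least half the union bound
  \<open>k x\<close> cut off at 1, because \<open>exp (- y) \<le> 1 / (1 + y)\<close>.\<close>

lemma one_minus_power_bound:
  fixes x :: real
  assumes "0 \<le> x" "x \<le> 1"
  shows "min 1 (real k * x) / 2 \<le> 1 - (1 - x) ^ k"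
proof -
  define y where "y = real k * x"
  have y: "0 \<le> y" using assms by (simp add: y_def)
  have "(1 - x) ^ k \<le> exp (- y)"
    using one_minus_power_le_exp[OF assms] by (simp add: y_def)
  also have "\<dots> \<le> 1 / (1 + y)"
    using exp_ge_add_one_self[of y] y by (simp add: exp_minus field_simps)
  also have "\<dots> \<le> 1 - min 1 y / 2"
  proof (cases "y \<le> 1")
    case True
    then have "0 \<le> y * (1 - y)" using y by simp
    then show ?thesis using True y by (simp add: field_simps)
  qed (use y in \<open>simp add: field_simps\<close>)
  finally show ?thesis by (simp add: y_def)
qed

lemma exp_ge_square_half:
  fixes x :: real
  assumes "0 \<le> x"
  shows "x\<^sup>2 / 2 \<le> exp x"
  using exp_lower_Taylor_quadratic[OF assms] assms by linarith

lemma exp_8_ge: "1024 \<le> exp (8::real)"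
proof -
  have *: "(2.5::real) \<le> exp 1" using exp_lower_Taylor_quadratic[of "1::real"] by simp
  have "(2.5::real) ^ 8 \<le> exp 1 ^ 8" by (intro power_mono *) auto
  also have "exp 1 ^ 8 = exp (8::real)" by (simp flip: exp_of_nat_mult)
  moreover have "1024 \<le> (2.5::real) ^ 8" by (simp add: power_numeral_reduce)
  ultimately show ?thesis by linarith
qed

text \<open>Here \<open>r\<close> plays the role of the trade probability. The constant 64 is 8
  times 8: for \<open>q \<ge> r / 8\<close> it gives
  \<open>c q \<ge> 8 (1 + ln (m / n) + ln (1 / r))\<close>.\<close>

locale market_size =
  fixes m n c :: nat and r :: real
  assumes n: "1 \<le> n" "n \<le> m" and r: "0 < r" "r < 1"
    and c: "64 * (1 + ln (real m / real n) + ln (1 / r)) \<le> real c * r"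
begin

lemma c_ge: "64 \<le> real c * r" "64 \<le> real c"
proof -
  have "0 \<le> ln (real m / real n)" "0 \<le> ln (1 / r)" using n r by auto
  then have "64 * 1 \<le> 64 * (1 + ln (real m / real n) + ln (1 / r))"
    by (intro mult_left_mono) (simp_all only: add_increasing2 le_add_same_cancel1 order_refl zero_le_numeral)
  then show "64 \<le> real c * r" using order_trans[OF _ c] by simp
  also have "\<dots> \<le> real c" using r by (simp add: mult_left_le)
  finally show "64 \<le> real c" .
qed

text \<open>The left side will bound the expected loss, the right side the expected gain. Since
  \<open>(1 - q) ^ c\<close> is at most \<open>exp (- c q)\<close>, it absorbs the factors
  \<open>m / n\<close> and \<open>1 / r\<close> of the loss; both sides are compared with
  \<open>min 1 (c p) / 4\<close>.\<close>

lemma balance_large_seller_prob: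
  assumes p: "0 \<le> p" "p \<le> 1" and q: "r / 8 \<le> q" "q \<le> 1"
  shows "(1 - q) ^ c * min 1 (8 * real (m + c) * p / (real n * q))
    \<le> (1 - (1 - p) ^ c) * (1 - 2 * (1 - q / 2) ^ c)"
proof -
  have q0: "0 < q" using q r by linarith
  have cq: "real c * r \<le> real c * q * 8"
    using mult_left_mono[OF q(1), of "real c * 8"] by simp
  have "(1 - q / 2) ^ c \<le> exp (- (real c * (q / 2)))"
    using q q0 by (intro one_minus_power_le_exp) auto
  also have "\<dots> \<le> exp (- 4)"
    unfolding exp_le_cancel_iff using cq c_ge(1) by (simp only: times_divide_eq_right)
  also have "\<dots> \<le> 1 / 8"
    using exp_ge_square_half[of 4] by (simp add: exp_minus field_simps)
  finally have half: "1 / 2 \<le> 1 - 2 * (1 - q / 2) ^ c" by simp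
  have E: "(1 - q) ^ c \<le> exp (- 8) * (real n * r / real m)"
  proof -
    have "(1 - q) ^ c \<le> exp (- (real c * q))"
      using q q0 by (intro one_minus_power_le_exp) auto
    also have "\<dots> \<le> exp (- 8 * (1 + ln (real m / real n) + ln (1 / r)))"
      using c cq by simp
    also have "\<dots> \<le> exp (- 8 - ln (real m / real n) - ln (1 / r))"
      using n r by simp
    also have "\<dots> = exp (- 8) * (real n * r / real m)"
      using n r by (simp add: exp_diff exp_ln)
    finally show ?thesis .
  qed
  have e8: "exp (- 8::real) \<le> 1 / 1024"
    using exp_8_ge by (simp add: exp_minus field_simps)
  have "real n * r \<le> real m * 1"
    using n r by (intro mult_mono) auto
  then have nrm: "real n * r / real m \<le> 1" using n by (simp only: divide_le_eq_1_pos of_nat_0_less_iff mult_1_right)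
  have q1: "0 \<le> (1 - q) ^ c" using q by simp
  have "(1 - q) ^ c * min 1 (8 * real (m + c) * p / (real n * q)) \<le> min 1 (real c * p) / 4"
  proof (cases "1 \<le> real c * p")
    case True
    have "(1 - q) ^ c * min 1 (8 * real (m + c) * p / (real n * q)) \<le> (1 - q) ^ c * 1"
      using q1 by (intro mult_left_mono) auto
    also have "\<dots> \<le> exp (- 8) * 1" 
    proof -
      have "exp (- 8) * (real n * r / real m) \<le> exp (- 8) * 1"
        by (intro mult_left_mono nrm) simp
      then show ?thesis using E by linarith
    qed
    finally show ?thesis using True e8 by simp
  next
    case False
    have mc: "real (m + c) \<le> real m * (1 + real c)"
      using n mult_left_mono[of 1 "real m" "real c"] by (simp add: algebra_simps)
    have "(1 - q) ^ c * min 1 (8 * real (m + c) * p / (real n * q)) \<le>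
        (1 - q) ^ c * (8 * real (m + c) * p / (real n * q))"
      using q1 by (intro mult_left_mono) auto
    also have "\<dots> \<le> exp (- 8) * (real n * r / real m) * (8 * (real m * (1 + real c)) * p / (real n * (r / 8)))"
      using E mc q r n p by (intro mult_mono frac_le mult_nonneg_nonneg divide_nonneg_nonneg) auto
    also have "\<dots> = exp (- 8) * 64 * (1 + real c) * p" using n r by (simp add: field_simps)
    also have "\<dots> \<le> 1 / 1024 * 64 * (2 * real c) * p"
      using e8 c_ge p by (intro mult_mono) auto
    also have "\<dots> \<le> real c * p / 4" using p by simp
    finally show ?thesis using False by simp
  qed
  also have "\<dots> = min 1 (real c * p) / 2 * (1 / 2)" by simp
  also have "\<dots> \<le> (1 - (1 - p) ^ c) * (1 - 2 * (1 - q / 2) ^ c)"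
    using one_minus_power_bound[OF p, of c] half p by (intro mult_mono) (auto simp: power_le_one)
  finally show ?thesis .
qed

text \<open>When sellers at or below the price are rare, the loss is controlled by the matched pairs
  and decays exponentially in \<open>(n + c) r\<close>, which beats the prefactor
  \<open>n + c\<close>. Both sides are compared with \<open>min 1 (c q) / 4\<close>.\<close>

lemma balance_small_seller_prob:
  assumes p: "g \<le> p" "p \<le> 1" and q: "0 \<le> q" "q < r / 8" and g: "r - q \<le> g"
  shows "real (n + c) * q * (1 + q - g / 2) ^ (n + c - 1)
    \<le> (1 - (1 - p) ^ c) * (1 - (1 - q) ^ c)"
proof -
  define y where "y = real (n + c) * r"
  have p0: "7 * r / 8 \<le> p" "0 \<le> p" using p q g r by auto
  have "real c * r \<le> y"
    unfolding y_def using r by (intro mult_right_mono) auto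
  then have y: "64 \<le> y" using c_ge(1) by linarith
  have "(1 - p) ^ c \<le> exp (- (real c * p))"
    using p p0 by (intro one_minus_power_le_exp) auto
  also have "\<dots> \<le> exp (- 4)"
  proof -
    have "real c * (7 * r / 8) \<le> real c * p"
      using p0(1) by (rule mult_left_mono) simp
    then have "4 \<le> real c * p" using c_ge(1) by argo
    then show ?thesis by (simp only: exp_le_cancel_iff neg_le_iff_le)
  qed
  also have "\<dots> \<le> 1 / 8"
    using exp_ge_square_half[of 4] by (simp add: exp_minus field_simps)
  finally have half: "1 / 2 \<le> 1 - (1 - p) ^ c" by simp
  \<comment> \<open>From \<open>q < r / 8\<close> and \<open>g \<ge> 7 r / 8\<close> the base is at
    most \<open>1 + r / 8 - 7 r / 16\<close>.\<close>
  have "(1 + q - g / 2) ^ (n + c - 1) \<le> (1 - 5 * r / 16) ^ (n + c - 1)"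
    using q g r p by (intro power_mono) auto
  also have "\<dots> \<le> exp (- (real (n + c - 1) * (5 * r / 16)))"
    using r by (intro one_minus_power_le_exp) auto
  \<comment> \<open>Passing from exponent \<open>n + c - 1\<close> to \<open>n + c\<close> costs the
    factor \<open>exp (5 r / 16)\<close>, which is at most 2.\<close>
  also have "\<dots> = exp (5 * r / 16) * exp (- (5 * y / 16))"
  proof -
    have k: "real (n + c) = real (n + c - 1) + 1" using n by (simp add: of_nat_diff)
    have "- (k * (5 * r / 16)) = 5 * r / 16 + - (5 * ((k + 1) * r) / 16)" for k
      by (simp add: field_simps)
    then show ?thesis unfolding y_def k exp_add[symmetric] by (rule arg_cong)
  qed
  also have "\<dots> \<le> 2 * (1 / y)"
  proof (intro mult_mono)
    have "exp (5 * r / 16) \<le> 1 + 5 * r / 16 + (5 * r / 16)\<^sup>2"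
      using r by (intro exp_bound) auto
    also have "(5 * r / 16)\<^sup>2 \<le> (5 / 16)\<^sup>2"
      using r by (intro power_mono) auto
    finally show "exp (5 * r / 16) \<le> 2" using r by (simp add: power2_eq_square)
    \<comment> \<open>This amounts to \<open>25 y / 512 \<ge> 1\<close>, which holds as
      \<open>y \<ge> 64\<close>.\<close>
    have "y \<le> (5 * y / 16)\<^sup>2 / 2"
      using y mult_mono[of 64 y y y] by (simp add: power2_eq_square field_simps)
    also have "\<dots> \<le> exp (5 * y / 16)" using y by (intro exp_ge_square_half) auto
    finally show "exp (- (5 * y / 16)) \<le> 1 / y" using y by (simp add: exp_minus field_simps)
  qed auto
  finally have "real (n + c) * q * (1 + q - g / 2) ^ (n + c - 1) \<le> real (n + c) * q * (2 * (1 / y))"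
    using q by (intro mult_left_mono) auto
  also have "\<dots> = 2 * q / r" using n r by (simp add: y_def)
  also have "\<dots> \<le> min 1 (real c * q) / 4"
  proof -
    have "2 * q / r \<le> 1 / 4" using q r by (simp add: field_simps)
    moreover have "8 / r \<le> real c" using c_ge r by (simp add: field_simps)
    then have "8 / r * q \<le> real c * q" using q by (intro mult_right_mono) auto
    ultimately show ?thesis by simp
  qed
  also have "\<dots> = 1 / 2 * (min 1 (real c * q) / 2)" by simp
  also have "\<dots> \<le> (1 - (1 - p) ^ c) * (1 - (1 - q) ^ c)"
    using one_minus_power_bound[of q c] half q r by (intro mult_mono) auto
  finally show ?thesis .
qed

end

text \<open>The summand \<open>64 / r\<close> carries no logarithm, but
  \<open>ln r \<le> r - 1\<close> gives \<open>1 \<le> r + ln (1 / r)\<close>. After clearing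
  \<open>r\<close>, the coefficient of the logarithm is 128 and that of \<open>r\<close> is 65, so
  129 covers both; the \<open>+ 1\<close> accounts for rounding up.\<close>

lemma recruitment_bound:
  fixes r L :: real
  assumes "0 < r" "r < 1" "0 \<le> L"
  shows "64 * (1 + L + ln (1 / r)) / r + 1 \<le> 129 * (1 + (L + ln (1 / r)) / r)"
proof -
  define l where "l = ln (1 / r)"
  have l: "0 \<le> l" "l = - ln r" using assms by (simp_all add: l_def ln_div)
  have "1 \<le> r + l" using ln_le_minus_one[of r] assms l by simp
  then have "64 * (1 + L + l) + r \<le> 129 * (r + (L + l))"
    using assms l by argo
  then have "(64 * (1 + L + l) + r) / r \<le> 129 * (r + (L + l)) / r"
    using assms by (intro divide_right_mono) auto
  then show ?thesis
    using assms unfolding l_def[symmetric] by (simp add: add_divide_distrib distrib_left)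
qed

section \<open>Gain and loss at a fixed price\<close>

text \<open>For \<open>k \<ge> x / 4\<close> the first summand dominates, otherwise the second is at least \<open>1\<close>.\<close>

lemma inverse_le_exponential:
  fixes x :: real
  assumes "0 < x" "1 \<le> k"
  shows "1 / real k \<le> 4 / x + exp (x / 4) * (1 / 2) ^ k"
proof (cases "x / 4 \<le> real k")
  case True
  then have "1 / real k \<le> 4 / x" using assms by (simp add: field_simps)
  then show ?thesis by (smt (verit) exp_ge_zero mult_nonneg_nonneg zero_le_power divide_nonneg_nonneg)
next
  case False
  have "(2::real) ^ k \<le> exp 1 ^ k"
    using exp_ge_add_one_self[of 1] by (intro power_mono) auto
  also have "\<dots> = exp (real k)" by (simp flip: exp_of_nat_mult)
  also have "\<dots> \<le> exp (x / 4)" using False by simp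
  finally have "1 \<le> exp (x / 4) * (1 / 2) ^ k" by (simp add: power_divide)
  moreover have "1 / real k \<le> 1" using assms by simp
  moreover have "0 \<le> 4 / x" using assms by simp
  ultimately show ?thesis by linarith
qed


lemma of_bool_mult_le_of_nat:
  "(P \<Longrightarrow> Q \<Longrightarrow> 1 \<le> k) \<Longrightarrow> (of_bool P * of_bool Q :: ennreal) \<le> of_nat k"
  using of_nat_mono[of 1 k, where ?'a = ennreal] by (cases P; cases Q) auto

context double_auction
begin

definition p where "p t = B.prob {t<..}"
definition q where "q t = S.prob {..t}"
definition g where "g t = measure (FB \<Otimes>\<^sub>M FS) {x. t < snd x \<and> snd x \<le> fst x}"

lemma p_bounds: "0 \<le> p t" "p t \<le> 1" and q_bounds: "0 \<le> q t" "q t \<le> 1"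
  by (simp_all add: p_def q_def)

lemma generating_above:
  assumes "A \<subseteq> {..<m}" "0 \<le> u"
  shows "(\<integral>\<^sup>+ b. ennreal (u ^ num_above A t b) \<partial>PB m) = ennreal ((1 - (1 - u) * p t) ^ card A)"
  using B.nn_integral_PiM_generating[of "{..<m}" A "{}" "{t<..}" u 1] assms
  by (simp add: num_above_def p_def sets_FB)

lemma generating_below:
  assumes "A \<subseteq> {..<n}" "A' \<subseteq> {..<n}" "A \<inter> A' = {}" "0 \<le> u" "0 \<le> v"
  shows "(\<integral>\<^sup>+ s. ennreal (u ^ num_below A t s * v ^ num_below A' t s) \<partial>PS n) =
    ennreal ((1 - (1 - u) * q t) ^ card A * (1 - (1 - v) * q t) ^ card A')"
  using S.nn_integral_PiM_generating[of "{..<n}" A A' "{..t}" u v] assms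
  by (simp add: num_below_def q_def sets_FS)

lemma measurable_num_above_PB [measurable]:
  "A \<subseteq> {..<m} \<Longrightarrow> (\<lambda>b. num_above A t b) \<in> measurable (PB m) (count_space UNIV)"
  using measurable_PB_component by (intro measurable_num_above) (auto intro: finite_subset)

lemma measurable_num_below_PS [measurable]:
  "A \<subseteq> {..<n} \<Longrightarrow> (\<lambda>s. num_below A t s) \<in> measurable (PS n) (count_space UNIV)"
  using measurable_PS_component by (intro measurable_num_below) (auto intro: finite_subset)

lemma prob_num_above_ge:
  assumes "A \<subseteq> {..<m}"
  shows "ennreal (1 - (1 - p t) ^ card A) \<le> (\<integral>\<^sup>+ b. of_bool (1 \<le> num_above A t b) \<partial>PB m)"
proof (rule prob_space.nn_integral_ge_compl[OF prob_space_PB])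
  note [measurable] = measurable_num_above_PB[OF assms]
  show "(\<integral>\<^sup>+ b. ennreal (0 ^ num_above A t b) \<partial>PB m) \<le> ennreal ((1 - p t) ^ card A)"
    using generating_above[OF assms, of 0] by simp
  show "(\<lambda>b. of_bool (1 \<le> num_above A t b) :: ennreal) \<in> borel_measurable (PB m)"
    unfolding of_bool_def by measurable
  show "(\<lambda>b. ennreal (0 ^ num_above A t b)) \<in> borel_measurable (PB m)" by measurable
  show "1 \<le> of_bool (1 \<le> num_above A t b) + ennreal (0 ^ num_above A t b)" for b
    by (cases "num_above A t b") auto
qed (use p_bounds in auto)

text \<open>The second bound is Markov's inequality for \<open>(1 / 2) ^ N\<close>, with
  \<open>N\<close> the count: below 2 it satisfies \<open>2 (1 / 2) ^ N \<ge> 1\<close>. The first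
  uses \<open>0 ^ N\<close> instead.\<close>

lemma prob_num_below_ge:
  assumes "A \<subseteq> {..<n}"
  shows "ennreal (1 - (1 - q t) ^ card A) \<le> (\<integral>\<^sup>+ s. of_bool (1 \<le> num_below A t s) \<partial>PS n)"
    and "ennreal (1 - 2 * (1 - q t / 2) ^ card A) \<le> (\<integral>\<^sup>+ s. of_bool (2 \<le> num_below A t s) \<partial>PS n)"
proof -
  note [measurable] = measurable_num_below_PS[OF assms]
  have gen: "(\<integral>\<^sup>+ s. ennreal (u ^ num_below A t s) \<partial>PS n) = ennreal ((1 - (1 - u) * q t) ^ card A)"
    if "0 \<le> u" for u
    using generating_below[OF assms, of "{}" u 1] that by simp
  have meas: "(\<lambda>s. of_bool (k \<le> num_below A t s) :: ennreal) \<in> borel_measurable (PS n)" for k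
    unfolding of_bool_def by measurable
  show "ennreal (1 - (1 - q t) ^ card A) \<le> (\<integral>\<^sup>+ s. of_bool (1 \<le> num_below A t s) \<partial>PS n)"
  proof (rule prob_space.nn_integral_ge_compl[OF prob_space_PS meas])
    show "(\<integral>\<^sup>+ s. ennreal (0 ^ num_below A t s) \<partial>PS n) \<le> ennreal ((1 - q t) ^ card A)"
      using gen[of 0] by simp
    show "(\<lambda>s. ennreal (0 ^ num_below A t s)) \<in> borel_measurable (PS n)" by measurable
    show "1 \<le> of_bool (1 \<le> num_below A t s) + ennreal (0 ^ num_below A t s)" for s
      by (cases "num_below A t s") auto
  qed (use q_bounds in auto)
  show "ennreal (1 - 2 * (1 - q t / 2) ^ card A) \<le> (\<integral>\<^sup>+ s. of_bool (2 \<le> num_below A t s) \<partial>PS n)"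
  proof (rule prob_space.nn_integral_ge_compl[OF prob_space_PS meas])
    have "(\<integral>\<^sup>+ s. 2 * ennreal ((1 / 2) ^ num_below A t s) \<partial>PS n) = ennreal 2 * ennreal ((1 - q t / 2) ^ card A)"
      using gen[of "1 / 2"] by (subst nn_integral_cmult) auto
    then show "(\<integral>\<^sup>+ s. 2 * ennreal ((1 / 2) ^ num_below A t s) \<partial>PS n) \<le> ennreal (2 * (1 - q t / 2) ^ card A)"
      using q_bounds[of t] by (simp add: ennreal_mult)
    show "(\<lambda>s. 2 * ennreal ((1 / 2) ^ num_below A t s)) \<in> borel_measurable (PS n)" by measurable
    show "1 \<le> of_bool (2 \<le> num_below A t s) + 2 * ennreal ((1 / 2) ^ num_below A t s)" for s
    proof (cases "num_below A t s \<ge> 2")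
      case False
      then have "num_below A t s = 0 \<or> num_below A t s = 1" by auto
      moreover have "2 * ennreal (1 / 2) = 1"
        using ennreal_mult[of 2 "1 / 2"] by simp
      ultimately show ?thesis using False by auto
    qed simp
  qed (use q_bounds[of t] in auto)
qed

text \<open>One buyer above the price and one (or two) sellers at or below it make the minimum at
  least 1, and the two sides are independent. The second form sets one seller aside, to pay for the
  unit that Seller Trade Reduction may lose.\<close>

lemma gain_ge:
  assumes "A \<subseteq> {..<m}" "A' \<subseteq> {..<n}"
  shows "ennreal ((1 - (1 - p t) ^ card A) * (1 - (1 - q t) ^ card A')) \<le>
      (\<integral>\<^sup>+ \<omega>. of_nat (min (num_above A t (fst \<omega>)) (num_below A' t (snd \<omega>))) \<partial>market m n FB FS)"
    and "ennreal ((1 - (1 - p t) ^ card A) * (1 - 2 * (1 - q t / 2) ^ card A')) \<le>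
      (\<integral>\<^sup>+ \<omega>. of_nat (min (num_above A t (fst \<omega>)) (num_below A' t (snd \<omega>) - 1)) \<partial>market m n FB FS)"
proof -
  have meas: "(\<lambda>s. of_bool (k \<le> num_below A' t s) :: ennreal) \<in> borel_measurable (PS n)"
    "(\<lambda>b. of_bool (k \<le> num_above A t b) :: ennreal) \<in> borel_measurable (PB m)" for k
    using assms unfolding of_bool_def by measurable
  \<comment> \<open>The sign of this factor lets \<open>ennreal\<close> split the product even if
    the other factor is negative, where both sides are 0.\<close>
  have p: "0 \<le> 1 - (1 - p t) ^ card A" using p_bounds[of t] by (simp add: power_le_one)
  have "ennreal ((1 - (1 - p t) ^ card A) * (1 - (1 - q t) ^ card A')) \<le>
     (\<integral>\<^sup>+ b. of_bool (1 \<le> num_above A t b) \<partial>PB m) * (\<integral>\<^sup>+ s. of_bool (1 \<le> num_below A' t s) \<partial>PS n)"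
    using prob_num_above_ge[OF assms(1)] prob_num_below_ge(1)[OF assms(2)] p
    by (simp add: ennreal_mult' mult_mono)
  also have "\<dots> = (\<integral>\<^sup>+ \<omega>. of_bool (1 \<le> num_above A t (fst \<omega>)) * of_bool (1 \<le> num_below A' t (snd \<omega>)) \<partial>market m n FB FS)"
    by (rule nn_integral_market_mult[symmetric]) (rule meas)+
  also have "\<dots> \<le> (\<integral>\<^sup>+ \<omega>. of_nat (min (num_above A t (fst \<omega>)) (num_below A' t (snd \<omega>))) \<partial>market m n FB FS)"
    by (intro nn_integral_mono of_bool_mult_le_of_nat) auto
  finally show "ennreal ((1 - (1 - p t) ^ card A) * (1 - (1 - q t) ^ card A')) \<le> \<dots>" .
  have "ennreal ((1 - (1 - p t) ^ card A) * (1 - 2 * (1 - q t / 2) ^ card A')) \<le>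
     (\<integral>\<^sup>+ b. of_bool (1 \<le> num_above A t b) \<partial>PB m) * (\<integral>\<^sup>+ s. of_bool (2 \<le> num_below A' t s) \<partial>PS n)"
    using prob_num_above_ge[OF assms(1)] prob_num_below_ge(2)[OF assms(2)] p
    by (simp add: ennreal_mult' mult_mono)
  also have "\<dots> = (\<integral>\<^sup>+ \<omega>. of_bool (1 \<le> num_above A t (fst \<omega>)) * of_bool (2 \<le> num_below A' t (snd \<omega>)) \<partial>market m n FB FS)"
    by (rule nn_integral_market_mult[symmetric]) (rule meas)+
  also have "\<dots> \<le> (\<integral>\<^sup>+ \<omega>. of_nat (min (num_above A t (fst \<omega>)) (num_below A' t (snd \<omega>) - 1)) \<partial>market m n FB FS)"
    by (intro nn_integral_mono of_bool_mult_le_of_nat) auto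
  finally show "ennreal ((1 - (1 - p t) ^ card A) * (1 - 2 * (1 - q t / 2) ^ card A')) \<le> \<dots>" .
qed

text \<open>With no new seller at or below \<open>t\<close>, a loss means \<open>1 \<le> S \<le> B\<close>, whose indicator is at most \<open>B / S\<close>.\<close>

lemma loss_no_new_seller:
  assumes "1 \<le> n" "0 < q t"
  shows "(\<integral>\<^sup>+ \<omega>. of_bool (num_below {n..<n + c} t (snd \<omega>) = 0 \<and> lossy m (n + c) t (fst \<omega>) (snd \<omega>)) \<partial>market m (n + c) FB FS)
    \<le> ennreal ((1 - q t) ^ c * min 1 (8 * real m * p t / (real n * q t)))" (is "?L \<le> _")
proof -
  let ?M = "market m (n + c) FB FS"
  let ?N = "\<lambda>s. num_below {n..<n + c} t s" and ?S = "\<lambda>s. num_below {..<n} t s" and ?B = "\<lambda>b. num_above {..<m} t b"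
  define x where "x = real n * q t"
  have x: "0 < x" using assms by (simp add: x_def)
  have q1: "0 \<le> 1 - q t" using q_bounds by simp
  have [measurable]: "?N \<in> measurable (PS (n + c)) (count_space UNIV)" "?S \<in> measurable (PS (n + c)) (count_space UNIV)"
    by (auto intro!: measurable_num_below_PS)
  have gen: "(\<integral>\<^sup>+ s. ennreal (0 ^ ?N s * v ^ ?S s) \<partial>PS (n + c)) = ennreal ((1 - q t) ^ c * (1 - (1 - v) * q t) ^ n)" if "0 \<le> v" for v
    using generating_below[of "{n..<n+c}" "n + c" "{..<n}" 0 v t] that by (simp add: subset_eq Int_def)
  define f where "f v s = ennreal (0 ^ ?N s * v ^ ?S s)" for v :: real and s
  have [measurable]: "f v \<in> borel_measurable (PS (n + c))" for v
    unfolding f_def by measurable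
  have lin: "ennreal (a * y + b * z) = ennreal a * ennreal y + ennreal b * ennreal z"
    if "0 \<le> a" "0 \<le> b" "0 \<le> y" "0 \<le> z" for a b y z
    using that by (simp add: ennreal_plus ennreal_mult)
  have "?L \<le> (\<integral>\<^sup>+ \<omega>. 1 * ennreal (0 ^ ?N (snd \<omega>) * 1 ^ ?S (snd \<omega>)) \<partial>?M)"
    by (intro nn_integral_mono) auto
  also have "\<dots> = ennreal ((1 - q t) ^ c)"
    by (subst nn_integral_market_mult) (auto simp: gen[of 1, simplified] prob_space.emeasure_space_1[OF prob_space_PB])
  finally have L1: "?L \<le> ennreal ((1 - q t) ^ c)" .
  \<comment> \<open>In \<open>B / S\<close> the numerator is independent of the sellers, and
    bounding \<open>1 / S\<close> by a constant plus a multiple of \<open>(1 / 2) ^ S\<close> turns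
    the seller part into two generating functions.\<close>
  have "?L \<le> (\<integral>\<^sup>+ \<omega>. of_nat (?B (fst \<omega>)) * ennreal (4 / x * (0 ^ ?N (snd \<omega>) * 1 ^ ?S (snd \<omega>)) + exp (x / 4) * (0 ^ ?N (snd \<omega>) * (1 / 2) ^ ?S (snd \<omega>))) \<partial>?M)"
  proof (intro nn_integral_mono)
    fix \<omega> :: "(nat \<Rightarrow> real) \<times> (nat \<Rightarrow> real)"
    let ?k = "?S (snd \<omega>)"
    have *: "1 \<le> real (?B (fst \<omega>)) * (4 / x + exp (x / 4) * (1 / 2) ^ ?k)"
      if 0: "?N (snd \<omega>) = 0" and l: "lossy m (n + c) t (fst \<omega>) (snd \<omega>)"
    proof -
      \<comment> \<open>With no recruit at or below \<open>t\<close>, the sellers counted by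
        \<open>lossy\<close> are exactly original ones, whence
        \<open>1 \<le> S \<le> B\<close>.\<close>
      have "{j \<in> {..<n + c}. snd \<omega> j \<le> t} = {j \<in> {..<n}. snd \<omega> j \<le> t}"
        using 0 by (force simp: num_below_def)
      then have "1 \<le> ?k" "?k \<le> ?B (fst \<omega>)"
        using l by (auto simp: lossy_def num_below_def)
      then have "1 \<le> real (?B (fst \<omega>)) * (1 / real ?k)" by simp
      also have "\<dots> \<le> real (?B (fst \<omega>)) * (4 / x + exp (x / 4) * (1 / 2) ^ ?k)"
        using inverse_le_exponential[OF x \<open>1 \<le> ?k\<close>] by (intro mult_left_mono) auto
      finally show ?thesis .
    qed
    show "of_bool (?N (snd \<omega>) = 0 \<and> lossy m (n + c) t (fst \<omega>) (snd \<omega>)) \<le>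
      of_nat (?B (fst \<omega>)) * ennreal (4 / x * (0 ^ ?N (snd \<omega>) * 1 ^ ?k) + exp (x / 4) * (0 ^ ?N (snd \<omega>) * (1 / 2) ^ ?k))"
    proof (cases "?N (snd \<omega>) = 0 \<and> lossy m (n + c) t (fst \<omega>) (snd \<omega>)")
      case True
      then have "ennreal 1 \<le> ennreal (real (?B (fst \<omega>)) * (4 / x + exp (x / 4) * (1 / 2) ^ ?k))"
        using * by (intro ennreal_leI) auto
      also have "\<dots> = of_nat (?B (fst \<omega>)) * ennreal (4 / x + exp (x / 4) * (1 / 2) ^ ?k)"
        using x by (simp add: ennreal_mult ennreal_of_nat_eq_real_of_nat)
      finally show ?thesis using True by simp
    qed auto
  qed
  also have "\<dots> = ennreal (real m * p t) * (\<integral>\<^sup>+ s. ennreal (4 / x * (0 ^ ?N s * 1 ^ ?S s) + exp (x / 4) * (0 ^ ?N s * (1 / 2) ^ ?S s)) \<partial>PS (n + c))"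
    using measurable_num_above_PB[of "{..<m}" m t]
    by (subst nn_integral_market_mult) (simp_all add: nn_integral_num_above p_def)
  also have "(\<integral>\<^sup>+ s. ennreal (4 / x * (0 ^ ?N s * 1 ^ ?S s) + exp (x / 4) * (0 ^ ?N s * (1 / 2) ^ ?S s)) \<partial>PS (n + c)) =
    (\<integral>\<^sup>+ s. ennreal (4 / x) * f 1 s + ennreal (exp (x / 4)) * f (1 / 2) s \<partial>PS (n + c))"
    unfolding f_def using x by (intro nn_integral_cong lin) simp_all
  also have "\<dots> = ennreal (4 / x) * (\<integral>\<^sup>+ s. f 1 s \<partial>PS (n + c)) + ennreal (exp (x / 4)) * (\<integral>\<^sup>+ s. f (1 / 2) s \<partial>PS (n + c))"
    by (subst nn_integral_add) (simp_all add: nn_integral_cmult)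
  also have "\<dots> = ennreal (4 / x) * ennreal ((1 - q t) ^ c * (1 - (1 - 1) * q t) ^ n) + ennreal (exp (x / 4)) * ennreal ((1 - q t) ^ c * (1 - (1 - 1 / 2) * q t) ^ n)"
    unfolding f_def by (subst (1 2) gen) simp_all
  also have "\<dots> = ennreal (4 / x * ((1 - q t) ^ c * (1 - (1 - 1) * q t) ^ n) + exp (x / 4) * ((1 - q t) ^ c * (1 - (1 - 1 / 2) * q t) ^ n))"
    using x q1 q_bounds[of t] by (intro lin[symmetric]) simp_all
  also have "\<dots> = ennreal ((1 - q t) ^ c * (4 / x + exp (x / 4) * (1 - q t / 2) ^ n))"
    by (simp add: algebra_simps)
  also have "\<dots> \<le> ennreal ((1 - q t) ^ c * (8 / x))"
  proof (intro ennreal_leI mult_left_mono)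
    \<comment> \<open>The decay \<open>exp (- x / 2)\<close> beats the factor
      \<open>exp (x / 4)\<close> and leaves \<open>exp (- x / 4) \<le> 4 / x\<close>.\<close>
    have "(1 - q t / 2) ^ n \<le> exp (- (real n * (q t / 2)))"
      using q_bounds[of t] by (intro one_minus_power_le_exp) auto
    also have "\<dots> = exp (- (x / 2))" by (simp add: x_def)
    finally have "exp (x / 4) * (1 - q t / 2) ^ n \<le> exp (x / 4) * exp (- (x / 2))" by simp
    also have "\<dots> = 1 / exp (x / 4)" by (simp add: exp_minus field_simps flip: exp_add)
    also have "\<dots> \<le> 1 / (x / 4)"
    proof (rule divide_left_mono)
      show "x / 4 \<le> exp (x / 4)" using exp_ge_add_one_self[of "x / 4"] by linarith
    qed (use x in auto)
    finally show "4 / x + exp (x / 4) * (1 - q t / 2) ^ n \<le> 8 / x" by simp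
  qed (use q1 in auto)
  finally have "?L \<le> ennreal (real m * p t) * ennreal ((1 - q t) ^ c * (8 / x))"
    by (simp add: mult_left_mono)
  also have "\<dots> = ennreal ((1 - q t) ^ c * (8 * real m * p t / x))"
    using x q1 p_bounds[of t] by (simp add: ennreal_mult[symmetric] mult_ac)
  finally show ?thesis
    using L1 q1 by (simp add: x_def min_def)
qed

end

lemma pred_nat_comparison:
  fixes f g :: "'a \<Rightarrow> nat"
  assumes "f \<in> measurable M (count_space UNIV)" "g \<in> measurable M (count_space UNIV)"
  shows "Measurable.pred M (\<lambda>x. P (f x) (g x))"
proof (rule measurable_compose_countable[OF _ assms(1)])
  show "Measurable.pred M (\<lambda>x. P i (g x))" for i
    by (rule measurable_compose[OF assms(2)]) simp
qed

context double_auction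
begin

section \<open>Joint law of one buyer and one seller\<close>

lemma space_FB [simp]: "space FB = UNIV" and space_FS [simp]: "space FS = UNIV"
  using sets_eq_imp_space_eq[OF sets_FB] sets_eq_imp_space_eq[OF sets_FS] by simp_all

lemma measurable_pair_sets [measurable]:
  "{x. t < snd x \<and> snd x \<le> fst x} \<in> sets (FB \<Otimes>\<^sub>M FS)"
  "{x. snd x \<le> t} \<in> sets (FB \<Otimes>\<^sub>M FS)"
  "{x. t < fst x} \<in> sets (FB \<Otimes>\<^sub>M FS)"
proof -
  have [measurable]: "(\<lambda>x. fst x) \<in> borel_measurable (FB \<Otimes>\<^sub>M FS)" "(\<lambda>x. snd x) \<in> borel_measurable (FB \<Otimes>\<^sub>M FS)"
    by measurable
  have "{x \<in> space (FB \<Otimes>\<^sub>M FS). t < snd x \<and> snd x \<le> fst x} \<in> sets (FB \<Otimes>\<^sub>M FS)"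
    "{x \<in> space (FB \<Otimes>\<^sub>M FS). snd x \<le> t} \<in> sets (FB \<Otimes>\<^sub>M FS)"
    "{x \<in> space (FB \<Otimes>\<^sub>M FS). t < fst x} \<in> sets (FB \<Otimes>\<^sub>M FS)"
    by measurable
  then show "{x. t < snd x \<and> snd x \<le> fst x} \<in> sets (FB \<Otimes>\<^sub>M FS)"
  "{x. snd x \<le> t} \<in> sets (FB \<Otimes>\<^sub>M FS)"
  "{x. t < fst x} \<in> sets (FB \<Otimes>\<^sub>M FS)"
    by (simp_all add: space_pair_measure)
qed

lemma prob_snd_le: "BS.prob {x. snd x \<le> t} = q t"
proof -
  have eq: "{x. snd x \<le> t} = UNIV \<times> {..t}" by auto
  then have "emeasure (FB \<Otimes>\<^sub>M FS) {x. snd x \<le> t} = emeasure FS {..t}"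
    unfolding eq using S.emeasure_pair_measure_Times[of UNIV FB "{..t}"] B.emeasure_space_1
    by (simp add: sets_FB sets_FS)
  then show ?thesis by (simp add: measure_def q_def)
qed

lemma prob_fst_greater: "BS.prob {x. t < fst x} = p t"
proof -
  have eq: "{x. t < fst x} = {t<..} \<times> UNIV" by auto
  then have "emeasure (FB \<Otimes>\<^sub>M FS) {x. t < fst x} = emeasure FB {t<..}"
    unfolding eq using S.emeasure_pair_measure_Times[of "{t<..}" FB UNIV] S.emeasure_space_1
    by (simp add: sets_FB sets_FS)
  then show ?thesis by (simp add: measure_def p_def)
qed

lemma g_le_p: "g t \<le> p t"
  unfolding g_def prob_fst_greater[symmetric] by (intro BS.P.finite_measure_mono) auto

text \<open>A pair that can trade has its seller at or below \<open>t\<close> or is matched above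
  \<open>t\<close>. So \<open>q t\<close> and \<open>g t\<close> cannot both be small, which is the
  source of the case distinction on \<open>q t\<close>.\<close>

lemma trade_prob_le: "trade_prob FB FS \<le> g t + q t"
proof -
  have "trade_prob FB FS \<le> BS.prob ({x. t < snd x \<and> snd x \<le> fst x} \<union> {x. snd x \<le> t})"
    unfolding trade_prob_def by (intro BS.P.finite_measure_mono) auto
  also have "\<dots> \<le> g t + q t"
    unfolding g_def prob_snd_le[symmetric] by (intro measure_Un_le) auto
  finally show ?thesis .
qed

lemma g_plus_q_le_1: "g t + q t \<le> 1"
proof -
  have "g t + q t = BS.prob ({x. t < snd x \<and> snd x \<le> fst x} \<union> {x. snd x \<le> t})"
    unfolding g_def prob_snd_le[symmetric] by (intro BS.P.finite_measure_Union[symmetric]) auto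
  then show ?thesis by simp
qed

text \<open>The loss indicator is at most \<open>S 2\<^sup>S\<^sup>-\<^sup>1 2\<^sup>-\<^sup>G\<close>, where \<open>S\<close> counts the sellers at or below \<open>t\<close> and \<open>G\<close> the
  matched pairs above \<open>t\<close>; this is a sum over the sellers of products of independent factors.\<close>

lemma loss_few_matched:
  assumes "N \<le> M"
  shows "(\<integral>\<^sup>+ \<omega>. of_bool (lossy M N t (fst \<omega>) (snd \<omega>)) \<partial>market M N FB FS)
    \<le> ennreal (real N * q t * (1 + q t - g t / 2) ^ (N - 1))"
proof -
  \<comment> \<open>\<open>w\<close> is the factor that one index pair contributes to
    \<open>2 ^ S * (1 / 2) ^ G\<close>.\<close>
  define w :: "real \<times> real \<Rightarrow> real" where
    "w x = (if snd x \<le> t then 2 else 1) * (if t < snd x \<and> snd x \<le> fst x then 1 / 2 else 1)" for x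
  \<comment> \<open>Singling out seller \<open>j\<close> replaces its factor 2 by an indicator, so
    the sum over \<open>j\<close> produces the factor \<open>S\<close> and lowers the exponent to
    \<open>S - 1\<close>.\<close>
  define h :: "nat \<Rightarrow> nat \<Rightarrow> real \<times> real \<Rightarrow> real" where
    "h j i x = (if i = j then of_bool (snd x \<le> t) else w x)" for j i x
  \<comment> \<open>The two events are disjoint, so the product of factors is linear in their
    indicators and has mean \<open>1 + q t - g t / 2\<close>.\<close>
  have w_eq: "w = (\<lambda>x. 1 + indicator {x. snd x \<le> t} x - 1 / 2 * indicator {x. t < snd x \<and> snd x \<le> fst x} x)"
    by (auto simp: w_def fun_eq_iff)
  have w0: "0 \<le> w x" for x by (simp add: w_def)
  have h0: "0 \<le> h j i x" for i j x using w0 by (simp add: h_def)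
  have w_meas [measurable]: "w \<in> borel_measurable (FB \<Otimes>\<^sub>M FS)" unfolding w_eq by measurable
  have ob: "(\<lambda>x. of_bool (snd x \<le> t)) = (indicator {x. snd x \<le> t} :: real \<times> real \<Rightarrow> real)"
    by (auto simp: fun_eq_iff)
  have h_meas [measurable]: "h j i \<in> borel_measurable (FB \<Otimes>\<^sub>M FS)" for i j
    by (cases "i = j") (simp_all add: h_def[abs_def] ob w_meas)
  have wg: "0 \<le> 1 + q t - g t / 2" using g_plus_q_le_1[of t] q_bounds[of t] by linarith
  have int_w: "(\<integral>\<^sup>+ x. ennreal (w x) \<partial>(FB \<Otimes>\<^sub>M FS)) = ennreal (1 + q t - g t / 2)"
  proof -
    have int: "integrable (FB \<Otimes>\<^sub>M FS) (indicator E :: _ \<Rightarrow> real)" if "E \<in> sets (FB \<Otimes>\<^sub>M FS)" for E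
      using that by (simp add: BS.P.emeasure_eq_measure)
    have "(\<integral>\<^sup>+ x. ennreal (w x) \<partial>(FB \<Otimes>\<^sub>M FS)) = ennreal (\<integral>x. w x \<partial>(FB \<Otimes>\<^sub>M FS))"
      using w0 by (intro nn_integral_eq_integral BS.P.integrable_const_bound[where B = 2])
        (auto simp: w_def)
    also have "(\<integral>x. w x \<partial>(FB \<Otimes>\<^sub>M FS)) = 1 + q t - 1 / 2 * g t"
      unfolding w_eq using int
      by (subst Bochner_Integration.integral_diff, simp, simp, subst Bochner_Integration.integral_add)
        (simp_all add: prob_snd_le g_def BS.P.prob_space)
    finally show ?thesis by simp
  qed
  have int_q: "(\<integral>\<^sup>+ x. ennreal (of_bool (snd x \<le> t)) \<partial>(FB \<Otimes>\<^sub>M FS)) = ennreal (q t)"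
  proof -
    have "ennreal (of_bool (snd x \<le> t)) = indicator {x. snd x \<le> t} x" for x :: "real \<times> real"
      by simp
    then show ?thesis
      by (simp only: nn_integral_indicator measurable_pair_sets BS.P.emeasure_eq_measure prob_snd_le)
  qed
  have bound: "of_bool (lossy M N t (fst \<omega>) (snd \<omega>)) \<le>
      (\<Sum>j<N. \<Prod>i<N. h j i (fst \<omega> i, snd \<omega> i))" for \<omega> :: "(nat \<Rightarrow> real) \<times> (nat \<Rightarrow> real)"
  proof (cases "lossy M N t (fst \<omega>) (snd \<omega>)")
    case True
    define A where "A = {j \<in> {..<N}. snd \<omega> j \<le> t}"
    define G where "G = num_matched {..<N} t (fst \<omega>) (snd \<omega>)"
    have A: "A \<subseteq> {..<N}" "finite A" "1 \<le> card A" "G < card A"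
      using True by (auto simp: lossy_def num_below_def A_def G_def)
    have tot: "(\<Prod>i<N. w (fst \<omega> i, snd \<omega> i)) = 2 ^ card A * (1 / 2) ^ G"
    proof -
      have "(\<Prod>i<N. if snd \<omega> i \<le> t then 2 else 1) = (2::real) ^ card A"
        unfolding A_def by (subst prod.inter_filter[symmetric]) simp_all
      moreover have "(\<Prod>i<N. if t < snd \<omega> i \<and> snd \<omega> i \<le> fst \<omega> i then 1 / 2 else 1) = (1 / 2 :: real) ^ G"
        unfolding G_def num_matched_def by (subst prod.inter_filter[symmetric]) simp_all
      ultimately show ?thesis by (simp only: w_def fst_conv snd_conv prod.distrib)
    qed
    have summand: "(\<Prod>i<N. h j i (fst \<omega> i, snd \<omega> i)) = 2 ^ card A * (1 / 2) ^ G / 2" if j: "j \<in> A" for j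
    proof -
      have "(\<Prod>i<N. w (fst \<omega> i, snd \<omega> i)) = w (fst \<omega> j, snd \<omega> j) * (\<Prod>i\<in>{..<N} - {j}. w (fst \<omega> i, snd \<omega> i))"
        using j A(1) by (intro prod.remove) auto
      moreover have "(\<Prod>i<N. h j i (fst \<omega> i, snd \<omega> i)) = h j j (fst \<omega> j, snd \<omega> j) * (\<Prod>i\<in>{..<N} - {j}. h j i (fst \<omega> i, snd \<omega> i))"
        using j A(1) by (intro prod.remove) auto
      moreover have "(\<Prod>i\<in>{..<N} - {j}. h j i (fst \<omega> i, snd \<omega> i)) = (\<Prod>i\<in>{..<N} - {j}. w (fst \<omega> i, snd \<omega> i))"
        by (intro prod.cong) (auto simp: h_def)
      moreover have "w (fst \<omega> j, snd \<omega> j) = 2" "h j j (fst \<omega> j, snd \<omega> j) = 1"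
        using j by (auto simp: w_def h_def A_def)
      ultimately show ?thesis using tot by simp
    qed
    \<comment> \<open>\<open>G < S\<close> makes each of the \<open>S \<ge> 1\<close> nonzero
      summands at least 1.\<close>
    have "(2::real) ^ Suc G \<le> 2 ^ card A" using A(4) by (intro power_increasing) auto
    then have "1 \<le> 2 ^ card A * (1 / 2) ^ G / (2::real)" by (simp add: power_divide field_simps)
    also have "\<dots> \<le> (\<Sum>j\<in>A. 2 ^ card A * (1 / 2) ^ G / (2::real))"
      using A(3) mult_right_mono[of 1 "real (card A)" "2 ^ card A * (1 / 2) ^ G / 2"] by simp
    also have "\<dots> = (\<Sum>j\<in>A. \<Prod>i<N. h j i (fst \<omega> i, snd \<omega> i))"
      by (intro sum.cong refl summand[symmetric])
    also have "\<dots> \<le> (\<Sum>j<N. \<Prod>i<N. h j i (fst \<omega> i, snd \<omega> i))"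
      using A(1) h0 by (intro sum_mono2 prod_nonneg) simp_all
    finally show ?thesis using True by simp
  next
    case False
    then show ?thesis using h0 by (simp add: sum_nonneg prod_nonneg)
  qed
  have comp: "(\<lambda>\<omega>. h j i (fst \<omega> i, snd \<omega> i)) \<in> borel_measurable (market M N FB FS)" if "i < N" for i j
  proof -
    have "(\<lambda>x. (fst x i, snd x i)) \<in> measurable (PB M \<Otimes>\<^sub>M PS N) (FB \<Otimes>\<^sub>M FS)"
      using that assms(1) by (intro measurable_Pair)
        (auto intro!: measurable_compose[OF measurable_fst] measurable_compose[OF measurable_snd] measurable_component_singleton)
    from measurable_compose[OF this h_meas] show ?thesis unfolding market_def .
  qed
  have "(\<integral>\<^sup>+ \<omega>. of_bool (lossy M N t (fst \<omega>) (snd \<omega>)) \<partial>market M N FB FS) \<le>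
      (\<integral>\<^sup>+ \<omega>. (\<Sum>j<N. \<Prod>i<N. ennreal (h j i (fst \<omega> i, snd \<omega> i))) \<partial>market M N FB FS)"
  proof (intro nn_integral_mono)
    fix \<omega> :: "(nat \<Rightarrow> real) \<times> (nat \<Rightarrow> real)"
    have "ennreal (of_bool (lossy M N t (fst \<omega>) (snd \<omega>))) \<le> ennreal (\<Sum>j<N. \<Prod>i<N. h j i (fst \<omega> i, snd \<omega> i))"
      by (intro ennreal_leI bound)
    also have "\<dots> = (\<Sum>j<N. \<Prod>i<N. ennreal (h j i (fst \<omega> i, snd \<omega> i)))"
      using h0 by (simp add: prod_ennreal prod_nonneg flip: sum_ennreal)
    finally show "of_bool (lossy M N t (fst \<omega>) (snd \<omega>)) \<le> \<dots>" by (simp add: of_bool_def split: if_splits)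
  qed
  also have "\<dots> = (\<Sum>j<N. \<integral>\<^sup>+ \<omega>. (\<Prod>i<N. ennreal (h j i (fst \<omega> i, snd \<omega> i))) \<partial>market M N FB FS)"
    using comp by (intro nn_integral_sum borel_measurable_prod_ennreal) auto
  also have "\<dots> = (\<Sum>j<N. \<Prod>i<N. (\<integral>\<^sup>+ x. ennreal (h j i (fst x, snd x)) \<partial>(FB \<Otimes>\<^sub>M FS)))"
    by (intro sum.cong refl nn_integral_market_prod assms) (simp add: case_prod_unfold)
  also have "\<dots> = (\<Sum>j<N. ennreal (q t) * ennreal (1 + q t - g t / 2) ^ (N - 1))"
  proof (intro sum.cong refl)
    fix j assume j: "j \<in> {..<N}"
    have "(\<Prod>i<N. (\<integral>\<^sup>+ x. ennreal (h j i (fst x, snd x)) \<partial>(FB \<Otimes>\<^sub>M FS))) =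
      (\<integral>\<^sup>+ x. ennreal (h j j (fst x, snd x)) \<partial>(FB \<Otimes>\<^sub>M FS)) *
      (\<Prod>i\<in>{..<N} - {j}. (\<integral>\<^sup>+ x. ennreal (h j i (fst x, snd x)) \<partial>(FB \<Otimes>\<^sub>M FS)))"
      using j by (intro prod.remove) auto
    also have "(\<Prod>i\<in>{..<N} - {j}. (\<integral>\<^sup>+ x. ennreal (h j i (fst x, snd x)) \<partial>(FB \<Otimes>\<^sub>M FS))) =
      (\<Prod>i\<in>{..<N} - {j}. ennreal (1 + q t - g t / 2))"
      using int_w by (intro prod.cong) (auto simp: h_def)
    finally show "(\<Prod>i<N. (\<integral>\<^sup>+ x. ennreal (h j i (fst x, snd x)) \<partial>(FB \<Otimes>\<^sub>M FS))) =
      ennreal (q t) * ennreal (1 + q t - g t / 2) ^ (N - 1)"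
      using j int_q by (simp add: h_def)
  qed
  also have "\<dots> = ennreal (real N * q t * (1 + q t - g t / 2) ^ (N - 1))"
    using wg q_bounds[of t] by (simp add: ennreal_mult ennreal_power ennreal_of_nat_eq_real_of_nat mult.assoc)
  finally show ?thesis .
qed

section \<open>Comparison of the two markets at one price\<close>

lemma num_above_split: "num_above {..<m + c} t b = num_above {..<m} t b + num_above {m..<m + c} t b"
proof -
  have eq: "{j \<in> {..<m + c}. t < b j} = {j \<in> {..<m}. t < b j} \<union> {j \<in> {m..<m + c}. t < b j}" by auto
  show ?thesis unfolding num_above_def eq by (rule card_Un_disjoint) auto
qed

lemma num_below_split: "num_below {..<n + c} t s = num_below {..<n} t s + num_below {n..<n + c} t s"
proof -
  have eq: "{j \<in> {..<n + c}. s j \<le> t} = {j \<in> {..<n}. s j \<le> t} \<union> {j \<in> {n..<n + c}. s j \<le> t}" by auto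
  show ?thesis unfolding num_below_def eq by (rule card_Un_disjoint) auto
qed

text \<open>If the enlarged market has at most as many sellers below as buyers above the price, all new
  sellers below the price add trades; otherwise all new buyers above it do.\<close>

lemma trades_plus_gain_le:
  "min (num_above {..<m} t b) (num_below {..<n} t s) + min (num_above {m..<m + c} t b) (num_below {n..<n + c} t s)
    \<le> (min (num_above {..<m + c} t b) (num_below {..<n + c} t s) - of_bool (lossy (m + c) (n + c) t b s))
      + of_bool (lossy (m + c) (n + c) t b s)"
  "min (num_above {..<m} t b) (num_below {..<n} t s) + min (num_above {m..<m + c} t b) (num_below {n..<n + c} t s - 1)
    \<le> (min (num_above {..<m + c} t b) (num_below {..<n + c} t s) - of_bool (lossy (m + c) (n + c) t b s))
      + of_bool (num_below {n..<n + c} t s = 0 \<and> lossy (m + c) (n + c) t b s)"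
proof -
  let ?l = "lossy (m + c) (n + c) t b s"
  have l: "1 \<le> num_below {..<n} t s + num_below {n..<n + c} t s"
    "num_below {..<n} t s + num_below {n..<n + c} t s \<le> num_above {..<m} t b + num_above {m..<m + c} t b" if ?l
    using that by (auto simp: lossy_def num_above_split num_below_split)
  show "min (num_above {..<m} t b) (num_below {..<n} t s) + min (num_above {m..<m + c} t b) (num_below {n..<n + c} t s)
    \<le> (min (num_above {..<m + c} t b) (num_below {..<n + c} t s) - of_bool ?l) + of_bool ?l"
    unfolding num_above_split num_below_split by simp
  show "min (num_above {..<m} t b) (num_below {..<n} t s) + min (num_above {m..<m + c} t b) (num_below {n..<n + c} t s - 1)
    \<le> (min (num_above {..<m + c} t b) (num_below {..<n + c} t s) - of_bool ?l)
      + of_bool (num_below {n..<n + c} t s = 0 \<and> ?l)"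
    \<comment> \<open>In a loss the sellers are the short side, so the enlarged count is
      \<open>S + S'\<close>. One unit less still covers \<open>S + (S' - 1)\<close> if
      \<open>S' \<ge> 1\<close>; if \<open>S' = 0\<close>, the last indicator pays.\<close>
    using l unfolding num_above_split num_below_split
    by (cases ?l; cases "num_below {n..<n + c} t s") (auto simp: min_def)
qed

text \<open>Inside the enlarged market, old trades plus gain are at most the reduced trades plus
  loss at every outcome, so it suffices that the expected loss is at most the expected gain. Which
  pair of bounds shows this depends on whether \<open>q t\<close> reaches an eighth of the trade
  probability.\<close>

lemma fixed_price_bound:
  assumes n: "1 \<le> n" "n \<le> m" and r: "0 < trade_prob FB FS" "trade_prob FB FS < 1"
    and c: "64 * (1 + ln (real m / real n) + ln (1 / trade_prob FB FS)) \<le> real c * trade_prob FB FS"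
  shows "(\<integral>\<^sup>+ \<omega>. of_nat (min (num_above {..<m} t (fst \<omega>)) (num_below {..<n} t (snd \<omega>))) \<partial>market m n FB FS) \<le>
    (\<integral>\<^sup>+ \<omega>. of_nat (min (num_above {..<m + c} t (fst \<omega>)) (num_below {..<n + c} t (snd \<omega>))
       - of_bool (lossy (m + c) (n + c) t (fst \<omega>) (snd \<omega>))) \<partial>market (m + c) (n + c) FB FS)"
proof -
  interpret market_size m n c "trade_prob FB FS" by unfold_locales (use assms in auto)
  let ?M = "market (m + c) (n + c) FB FS"
  let ?X = "\<lambda>\<omega>. min (num_above {..<m} t (fst \<omega>)) (num_below {..<n} t (snd \<omega>))"
  let ?T = "\<lambda>\<omega>. min (num_above {..<m + c} t (fst \<omega>)) (num_below {..<n + c} t (snd \<omega>))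
       - of_bool (lossy (m + c) (n + c) t (fst \<omega>) (snd \<omega>))"
  have comp [measurable]: "j < m + c \<Longrightarrow> (\<lambda>\<omega>. fst \<omega> j) \<in> borel_measurable ?M"
    "j < n + c \<Longrightarrow> (\<lambda>\<omega>. fst \<omega> j) \<in> borel_measurable ?M"
    "j < n + c \<Longrightarrow> (\<lambda>\<omega>. snd \<omega> j) \<in> borel_measurable ?M" for j
    using measurable_market_component(1)[of j "m + c" "n + c"] measurable_market_component(2)[of j "n + c" "m + c"] n
    by auto
  have above [measurable]: "(\<lambda>\<omega>. num_above {..<m} t (fst \<omega>)) \<in> measurable ?M (count_space UNIV)"
    "(\<lambda>\<omega>. num_above {m..<m + c} t (fst \<omega>)) \<in> measurable ?M (count_space UNIV)"
    "(\<lambda>\<omega>. num_above {..<m + c} t (fst \<omega>)) \<in> measurable ?M (count_space UNIV)"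
    using comp by (intro measurable_num_above; simp)+
  have below [measurable]: "(\<lambda>\<omega>. num_below {..<n} t (snd \<omega>)) \<in> measurable ?M (count_space UNIV)"
    "(\<lambda>\<omega>. num_below {n..<n + c} t (snd \<omega>)) \<in> measurable ?M (count_space UNIV)"
    "(\<lambda>\<omega>. num_below {..<n + c} t (snd \<omega>)) \<in> measurable ?M (count_space UNIV)"
    using comp by (intro measurable_num_below; simp)+
  have matched [measurable]: "(\<lambda>\<omega>. num_matched {..<n + c} t (fst \<omega>) (snd \<omega>)) \<in> measurable ?M (count_space UNIV)"
    using comp by (intro measurable_num_matched) simp_all
  have lossy_meas [measurable]: "Measurable.pred ?M (\<lambda>\<omega>. lossy (m + c) (n + c) t (fst \<omega>) (snd \<omega>))"
    unfolding lossy_def using above(3) below(3) matched by (intro pred_intros_logic pred_nat_comparison measurable_const)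
  have sub: "{m..<m + c} \<subseteq> {..<m + c}" "{n..<n + c} \<subseteq> {..<n + c}"
    by auto
  \<comment> \<open>\<open>Y\<close> is the gain and \<open>L\<close> the loss event. After taking
    expectations the loss is cancelled, which is possible because the real bound \<open>a\<close>
    makes it finite.\<close>
  have compare: "(\<integral>\<^sup>+ \<omega>. of_nat (?X \<omega>) \<partial>?M) \<le> (\<integral>\<^sup>+ \<omega>. of_nat (?T \<omega>) \<partial>?M)"
    if Y: "(\<lambda>\<omega>. Y \<omega>) \<in> measurable ?M (count_space UNIV)"
      and L: "Measurable.pred ?M L"
      and le: "\<And>\<omega>. ?X \<omega> + Y \<omega> \<le> ?T \<omega> + of_bool (L \<omega>)"
      and Lb: "(\<integral>\<^sup>+ \<omega>. of_bool (L \<omega>) \<partial>?M) \<le> ennreal a"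
      and Yb: "ennreal b \<le> (\<integral>\<^sup>+ \<omega>. of_nat (Y \<omega>) \<partial>?M)"
      and ab: "a \<le> b" for Y :: "_ \<Rightarrow> nat" and L a b
  proof -
    note [measurable] = Y L
    have X [measurable]: "?X \<in> measurable ?M (count_space UNIV)" by measurable
    have T [measurable]: "?T \<in> measurable ?M (count_space UNIV)" unfolding of_bool_def by measurable
    have Lm [measurable]: "(\<lambda>\<omega>. of_bool (L \<omega>) :: ennreal) \<in> borel_measurable ?M" unfolding of_bool_def by measurable
    have "(\<integral>\<^sup>+ \<omega>. of_bool (L \<omega>) \<partial>?M) + (\<integral>\<^sup>+ \<omega>. of_nat (?X \<omega>) \<partial>?M) \<le>
        (\<integral>\<^sup>+ \<omega>. of_nat (Y \<omega>) \<partial>?M) + (\<integral>\<^sup>+ \<omega>. of_nat (?X \<omega>) \<partial>?M)"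
      using order_trans[OF Lb order_trans[OF ennreal_leI[OF ab] Yb]] by (rule add_right_mono)
    also have "\<dots> = (\<integral>\<^sup>+ \<omega>. of_nat (?X \<omega> + Y \<omega>) \<partial>?M)"
      unfolding of_nat_add using X Y by (subst nn_integral_add) (auto simp: add.commute)
    also have "\<dots> \<le> (\<integral>\<^sup>+ \<omega>. of_nat (?T \<omega> + of_bool (L \<omega>)) \<partial>?M)"
      by (intro nn_integral_mono of_nat_mono le)
    also have "\<dots> = (\<integral>\<^sup>+ \<omega>. of_bool (L \<omega>) + of_nat (?T \<omega>) \<partial>?M)"
      by (intro nn_integral_cong) (simp add: of_bool_def)
    also have "\<dots> = (\<integral>\<^sup>+ \<omega>. of_bool (L \<omega>) \<partial>?M) + (\<integral>\<^sup>+ \<omega>. of_nat (?T \<omega>) \<partial>?M)"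
      using T Lm by (intro nn_integral_add) auto
    finally show ?thesis
      using Lb by (auto simp: ennreal_add_left_cancel_le top_unique)
  qed
  have "(\<integral>\<^sup>+ \<omega>. of_nat (?X \<omega>) \<partial>market m n FB FS) = (\<integral>\<^sup>+ \<omega>. of_nat (?X \<omega>) \<partial>?M)"
  proof (rule nn_integral_market_restrict)
    show "(\<lambda>\<omega>. of_nat (?X \<omega>)) \<in> borel_measurable (market m n FB FS)"
      using measurable_market_component by measurable
    show "(of_nat (?X (restrict b {..<m}, restrict s {..<n})) :: ennreal) = of_nat (?X (b, s))" for b s
      by (simp add: num_above_def num_below_def cong: conj_cong)
  qed auto
  also have "\<dots> \<le> (\<integral>\<^sup>+ \<omega>. of_nat (?T \<omega>) \<partial>?M)"
  proof (cases "trade_prob FB FS / 8 \<le> q t")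
    case True
    let ?Y = "\<lambda>\<omega>. min (num_above {m..<m + c} t (fst \<omega>)) (num_below {n..<n + c} t (snd \<omega>) - 1)"
    let ?L = "\<lambda>\<omega>. num_below {n..<n + c} t (snd \<omega>) = 0 \<and> lossy (m + c) (n + c) t (fst \<omega>) (snd \<omega>)"
    have Y: "?Y \<in> measurable ?M (count_space UNIV)" by measurable
    have L: "Measurable.pred ?M ?L"
      by (intro pred_intros_logic pred_nat_comparison below(2) lossy_meas measurable_const) simp
    have le: "?X \<omega> + ?Y \<omega> \<le> ?T \<omega> + of_bool (?L \<omega>)" for \<omega>
      by (rule trades_plus_gain_le(2))
    have Lb: "(\<integral>\<^sup>+ \<omega>. of_bool (?L \<omega>) \<partial>?M) \<le> ennreal ((1 - q t) ^ c * min 1 (8 * real (m + c) * p t / (real n * q t)))"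
      using True r n by (intro loss_no_new_seller) auto
    have Yb: "ennreal ((1 - (1 - p t) ^ c) * (1 - 2 * (1 - q t / 2) ^ c)) \<le> (\<integral>\<^sup>+ \<omega>. of_nat (?Y \<omega>) \<partial>?M)"
      using gain_ge(2)[OF sub, of t] by simp
    show ?thesis
      by (rule compare[OF Y L le Lb Yb balance_large_seller_prob[OF p_bounds True q_bounds(2)]])
  next
    case False
    let ?Y = "\<lambda>\<omega>. min (num_above {m..<m + c} t (fst \<omega>)) (num_below {n..<n + c} t (snd \<omega>))"
    let ?L = "\<lambda>\<omega>. lossy (m + c) (n + c) t (fst \<omega>) (snd \<omega>)"
    have Y: "?Y \<in> measurable ?M (count_space UNIV)" by measurable
    have le: "?X \<omega> + ?Y \<omega> \<le> ?T \<omega> + of_bool (?L \<omega>)" for \<omega>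
      by (rule trades_plus_gain_le(1))
    have Lb: "(\<integral>\<^sup>+ \<omega>. of_bool (?L \<omega>) \<partial>?M) \<le> ennreal (real (n + c) * q t * (1 + q t - g t / 2) ^ (n + c - 1))"
      using n by (intro loss_few_matched) auto
    have Yb: "ennreal ((1 - (1 - p t) ^ c) * (1 - (1 - q t) ^ c)) \<le> (\<integral>\<^sup>+ \<omega>. of_nat (?Y \<omega>) \<partial>?M)"
      using gain_ge(1)[OF sub, of t] by simp
    have "q t < trade_prob FB FS / 8" "trade_prob FB FS - q t \<le> g t"
      using False trade_prob_le[of t] by linarith+
    then show ?thesis
      by (intro compare[OF Y lossy_meas le Lb Yb] balance_small_seller_prob g_le_p p_bounds q_bounds)
  qed
  finally show ?thesis .
qed

lemma OPT_le_STR: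
  assumes n: "1 \<le> n" "n \<le> m" and r: "0 < trade_prob FB FS" "trade_prob FB FS < 1"
    and c: "64 * (1 + ln (real m / real n) + ln (1 / trade_prob FB FS)) \<le> real c * trade_prob FB FS"
  shows "OPT_exp m n FB FS \<le> STR_exp (m + c) (n + c) FB FS"
proof -
  have "OPT_exp m n FB FS \<le> (\<integral>\<^sup>+ t. (\<integral>\<^sup>+ \<omega>. of_nat (min (num_above {..<m + c} t (fst \<omega>)) (num_below {..<n + c} t (snd \<omega>))
       - of_bool (lossy (m + c) (n + c) t (fst \<omega>) (snd \<omega>))) \<partial>market (m + c) (n + c) FB FS) \<partial>lborel)"
    unfolding OPT_exp_eq using assms by (intro nn_integral_mono fixed_price_bound) auto
  also have "\<dots> \<le> STR_exp (m + c) (n + c) FB FS"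
    using n by (intro STR_exp_ge) auto
  finally show ?thesis .
qed

end

section \<open>Choice of the number of recruits\<close>

theorem theorem1p3:
  shows "\<exists>K::real. K > 0 \<and>
    (\<forall>(m::nat) (n::nat) (FB::real measure) (FS::real measure).
       1 \<le> n \<and> n \<le> m \<and>
       prob_space FB \<and> sets FB = sets borel \<and>
       prob_space FS \<and> sets FS = sets borel \<and>
       0 < trade_prob FB FS \<and> trade_prob FB FS < 1 \<longrightarrow>
       (\<exists>c::nat. real c \<le> K * (1 + (ln (real m / real n) + ln (1 / trade_prob FB FS)) / trade_prob FB FS)
          \<and> OPT_exp m n FB FS \<le> STR_exp (m + c) (n + c) FB FS))"
proof (rule exI[of _ 129], intro conjI allI impI, goal_cases)
  case (2 m n FB FS)
  then interpret double_auction FB FS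
    by (simp add: double_auction_def double_auction_axioms_def)
  define r where "r = trade_prob FB FS"
  \<comment> \<open>The least natural number meeting the size condition; rounding up costs at most
    1.\<close>
  define c where "c = nat \<lceil>64 * (1 + ln (real m / real n) + ln (1 / r)) / r\<rceil>"
  have r: "0 < r" "r < 1" using 2 by (simp_all add: r_def)
  have L: "0 \<le> ln (real m / real n)" "0 \<le> ln (1 / r)" using 2 r by auto
  then have nonneg: "0 \<le> 64 * (1 + ln (real m / real n) + ln (1 / r)) / r"
    using r by (intro divide_nonneg_pos mult_nonneg_nonneg add_nonneg_nonneg) auto
  then have "64 * (1 + ln (real m / real n) + ln (1 / r)) / r \<le> real c"
    unfolding c_def by linarith
  then have "64 * (1 + ln (real m / real n) + ln (1 / r)) \<le> real c * r"
    using r by (simp only: pos_divide_le_eq)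
  moreover have "real c \<le> 64 * (1 + ln (real m / real n) + ln (1 / r)) / r + 1"
    using nonneg unfolding c_def by linarith
  then have "real c \<le> 129 * (1 + (ln (real m / real n) + ln (1 / r)) / r)"
    using recruitment_bound[OF r L(1)] by linarith
  ultimately show ?case
    using OPT_le_STR[of n m c] 2 unfolding r_def by (intro exI[of _ c]) simp
qed simp

end
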